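(* Suppose that $0<\tau_i<2/L_i$ for all $i\in\{1,\dots,N\}$ and $0<\beta\le0.5/\max_i\tau_i$. Let $$\bar\mu=\sigma_M(\mathbf H^{1/2}\mathbf M)\,\sigma_M(\Gamma)\,\big(\beta\sigma_M(\sqrt{\mathbf I-\mathbf W})+1\big),\quad c_1=\sigma_M^{1/2}(\mathbf H),\quad c_2=\sigma_m^{1/2}(\widehat{\mathbf H}_1),\quad \mu=\bar\mu/c_2,\quad \omega=\sqrt{c_1/c_2}.$$ Suppose that the sequences generated by the inexact recursion (D-iPGM) described in the context satisfy the following: there exist an integer $k_0>0$ and a sequence $\{\varrho_k\}$ such that $$\sup_{k\ge k_0}\{\varrho_k\}<1/\bar\mu,\qquad\text{and}\qquad \|\mathbf d^k\|\le\varrho_k\|\mathbf x^k-\mathbf x^{k+1}\|,\quad\forall k\ge k_0.$$ Suppose also that $\{\mathbf u^k\}$ converges to $\mathbf u^\infty$ and that the KKT mapping $\mathcal J$ is metrically subregular at $(\mathbf u^\infty,\mathbf 0)$. Then there exist an integer $\bar k>0$ and a constant $\kappa>0$ such that for all $k\ge\bar k$ $$\mathrm{dist}_{\mathbf H}(\mathbf u^{k+1},\mathcal M^* )\le\vartheta_k\,\mathrm{dist}_{\mathbf H}(\mathbf u^k,\mathcal M^* ),$$ with $$\vartheta_k=\frac{\mu(1+\omega)\varrho_k+\bar\vartheta}{1-\mu\varrho_k},\qquad \bar\vartheta^2=1-\frac{c_2^2}{c_1^2(\kappa\kappa_2c_1+1)^2}<1,$$ $$\kappa_2^2=\frac{\max\{3\sigma_M(\mathbf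 V^2)+\frac1{\beta^2},\;3\max_i\{L_i^2\}+3\sigma_m(\Gamma^{-2})\}}{\sigma_m(\widehat{\mathbf H}_1)}$$ (with $\bar\vartheta\ge0$, $\kappa_2>0$). Moreover, if $$\sup_{k\ge\bar k}\{\varrho_k\}<\frac{1-\bar\vartheta}{\mu(2+\omega)},$$ then $\vartheta_k<1$ for all $k\ge\bar k$, and thus the convergence rate of $\mathrm{dist}_{\mathbf H}(\mathbf u^k,\mathcal M^* )$ is Q-linear.
   Context: Problem. Let $N,n\ge1$ and consider $\min_{\mathrm x\in\mathbb R^n}\sum_{i=1}^N (f_i(\mathrm x)+g_i(\mathrm x))$, where each $f_i:\mathbb R^n\to\mathbb R$ is convex and $L_i$-smooth (differentiable with $L_i$-Lipschitz gradient, $L_i>0$), and each $g_i:\mathbb R^n\to\mathbb R\cup\{\infty\}$ is proper, closed and convex (not necessarily smooth). An optimal solution is assumed to exist. For $\mathbf x=\mathrm{col}\{\mathrm x_1,\dots,\mathrm x_N\}\in\mathbb R^{Nn}$ (stacked vector) put $F(\mathbf x)=\sum_i f_i(\mathrm x_i)$, $G(\mathbf x)=\sum_i g_i(\mathrm x_i)$, $\mathbf L_F=\mathrm{diag}\{L_1\mathbf I_n,\dots,L_N\mathbf I_n\}$. Network. $\mathcal G=(\mathcal V,\mathcal E)$ is an undirected connected graph on $N$ vertices. $W=[W_{ij}]\in\mathbb R^{N\times N}$ is symmetric and doubly stochastic, the null space of $\mathbf I-W$ is $\mathrm{Span}(\mathbf 1)$, $W_{ij}=W_{ji}=0$ if $(i,j)\notin\mathcal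 E$ and $i\ne j$, and $W_{ij}>0$ otherwise. Let $\mathbf W=W\otimes\mathbf I_n$ and $\mathbf V=\sqrt{\mathbf I-\mathbf W}$ (positive semidefinite square root). The problem is equivalent to $\min_{\mathbf x}F(\mathbf x)+G(\mathbf x)$ subject to $\mathbf V\mathbf x=\mathbf 0$. Saddle points and KKT mapping. $\mathcal M=\mathbb R^{Nn}\times\mathbb R^{Nn}$, $L(\mathbf x,\boldsymbol\alpha)=F(\mathbf x)+G(\mathbf x)-\langle\boldsymbol\alpha,\mathbf V\mathbf x\rangle$, and $\mathcal M^*\subseteq\mathcal M$ is the set of $(\mathbf x^*,\boldsymbol\alpha^* )$ with $L(\mathbf x^*,\boldsymbol\alpha)\le L(\mathbf x^*,\boldsymbol\alpha^* )\le L(\mathbf x,\boldsymbol\alpha^* )$ for all $(\mathbf x,\boldsymbol\alpha)\in\mathcal M$. The KKT mapping is the set-valued map $$\mathcal J(\mathbf u)=\begin{pmatrix}\partial G(\mathbf x)+\nabla F(\mathbf x)-\mathbf V\boldsymbol\alpha\\ \mathbf V\mathbf x\end{pmatrix},\qquad \mathbf u=\mathrm{col}\{\mathbf x,\boldsymbol\alpha\};$$ one has $\mathbf u^*\in\mathcal M^*$ if and only if $\mathbf 0\in\mathcal J(\mathbf u^* )$. Metric subregularity. A set-valued mapping $\Psi:\mathbb R^p\rightrightarrows\mathbb R^q$ is metrically subregular at $(\bar u,\bar v)\in\mathrm{gph}(\Psi)=\{(u,v):v\in\Psi(u)\}$ if for some $\epsilon>0$ there exists $\kappa\ge0$ such that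 $\mathrm{dist}(u,\Psi^{-1}(\bar v))\le\kappa\,\mathrm{dist}(\bar v,\Psi(u))$ for all $u$ with $\|u-\bar u\|<\epsilon$, where $\Psi^{-1}(v)=\{u:(u,v)\in\mathrm{gph}(\Psi)\}$. Norms and notation. $\sigma_m(A)$ and $\sigma_M(A)$ are the smallest and largest nonzero singular values of $A$. For a symmetric positive definite matrix $\mathcal H$, $\|\mathbf z\|_{\mathcal H}^2=\langle\mathbf z,\mathcal H\mathbf z\rangle$, $\mathrm{dist}_{\mathcal H}(\mathbf z,\mathcal D)=\min_{\mathbf z'\in\mathcal D}\|\mathbf z-\mathbf z'\|_{\mathcal H}$ (subscript omitted for $\mathcal H=\mathbf I$) and $\mathrm{prox}_\theta^{\mathcal H}(\mathbf x)=\arg\min_{\mathbf y}\{\theta(\mathbf y)+\tfrac12\|\mathbf y-\mathbf x\|_{\mathcal H}^2\}$. A nonnegative sequence $\{a_k\}$ converges to $0$ Q-linearly if there is $q\in(0,1)$ with $a_{k+1}\le q\,a_k$ for all sufficiently large $k$. Matrices. With $\tau_i>0$, $\beta>0$, $\Gamma=\mathrm{diag}\{\tau_1\mathbf I_n,\dots,\tau_N\mathbf I_n\}$, set $$\mathbf Q=\begin{pmatrix}\Gamma^{-1}&\mathbf V\\ \mathbf 0&\frac1\beta\mathbf I\end{pmatrix},\quad \mathbf M=\begin{pmatrix}\mathbf I&\Gamma\mathbf V\\ \mathbf 0&\mathbf I\end{pmatrix},\quad \mathbf H=\mathbf Q\mathbf M^{-1},\quad \mathbf G=\mathbf Q^{\sf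 T}+\mathbf Q-\mathbf M^{\sf T}\mathbf H\mathbf M,\quad \widehat{\mathbf H}_1=\mathbf G-\tfrac12\mathrm{diag}\{\mathbf L_F,\mathbf 0\}.$$ Algorithm (D-iPGM). Let $\{\varepsilon_k\}$ be a summable sequence of nonnegative numbers. Starting from any $\mathbf x^0\in\mathbb R^{Nn}$ and $\boldsymbol\alpha^0=\mathbf 0$, for $k\ge0$, $$\tilde{\mathbf x}^k=\mathrm{prox}_G^{\Gamma^{-1}}\big(\mathbf x^k-\Gamma(\nabla F(\mathbf x^k)-\mathbf V\boldsymbol\alpha^k-\mathbf d^k)\big),\quad \tilde{\boldsymbol\alpha}^k=\boldsymbol\alpha^k-\beta\mathbf V\tilde{\mathbf x}^k,\quad \mathbf u^{k+1}=\mathbf u^k-\mathbf M(\mathbf u^k-\tilde{\mathbf u}^k),$$ where $\mathbf u^k=\mathrm{col}\{\mathbf x^k,\boldsymbol\alpha^k\}$, $\tilde{\mathbf u}^k=\mathrm{col}\{\tilde{\mathbf x}^k,\tilde{\boldsymbol\alpha}^k\}$, and $\mathbf d^k=\mathrm{col}\{\mathrm d_1^k,\dots,\mathrm d_N^k\}$ is an arbitrary error vector (the residual of the inexactly solved proximal subproblems) with $\|\mathrm d_i^k\|\le\varepsilon_k$ for all $i$.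
   Formalization: The tolerances ϱ_k are assumed nonnegative for k ≥ k_0, and the inequality dist_H(u^{k+1},M* ) ≤ ϑ_k dist_H(u^k,M* ) is asserted only for those k ≥ k̄ with μϱ_k < 1 (positive denominator of ϑ_k); without these the claim is false. *)

theory Defs
  imports "HOL-Analysis.Analysis"
begin

text \<open>
  The agents are indexed by the type \<open>'N\<close> and the coordinates of the decision variable by \<open>'n\<close>,
  so that \<open>N\<close> and \<open>n\<close> are the (arbitrary, positive) cardinalities of these types.
  The stacked vector \<open>col {x_1, ..., x_N}\<close> has entries indexed by pairs \<open>(i, j)\<close>, and a
  primal-dual pair is a vector indexed by the sum of two copies of that index type.
\<close>

type_synonym ('N, 'n) svec = "real ^ ('N \<times> 'n)"
type_synonym ('N, 'n) smat = "real ^ ('N \<times> 'n) ^ ('N \<times> 'n)"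
type_synonym ('N, 'n) pdvec = "real ^ (('N \<times> 'n) + ('N \<times> 'n))"
type_synonym ('N, 'n) pdmat =
  "real ^ (('N \<times> 'n) + ('N \<times> 'n)) ^ (('N \<times> 'n) + ('N \<times> 'n))"

definition agent_block :: "real ^ ('N::finite \<times> 'n::finite) \<Rightarrow> 'N \<Rightarrow> real ^ 'n" where
  "agent_block x i = (\<chi> j. x $ (i, j))"

definition col :: "real ^ 'a::finite \<Rightarrow> real ^ 'b::finite \<Rightarrow> real ^ ('a + 'b)" where
  "col x y = (\<chi> p. case p of Inl a \<Rightarrow> x $ a | Inr b \<Rightarrow> y $ b)"

definition upper :: "real ^ ('a::finite + 'b::finite) \<Rightarrow> real ^ 'a" where
  "upper u = (\<chi> a. u $ Inl a)"

definition lower :: "real ^ ('a::finite + 'b::finite) \<Rightarrow> real ^ 'b" where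
  "lower u = (\<chi> b. u $ Inr b)"

definition block_mat ::
  "real ^ 'c::finite ^ 'a::finite \<Rightarrow> real ^ 'd::finite ^ 'a \<Rightarrow> real ^ 'c ^ 'b::finite
    \<Rightarrow> real ^ 'd ^ 'b \<Rightarrow> real ^ ('c + 'd) ^ ('a + 'b)" where
  "block_mat A B C D = (\<chi> p q.
     case p of
       Inl a \<Rightarrow> (case q of Inl c \<Rightarrow> A $ a $ c | Inr d \<Rightarrow> B $ a $ d)
     | Inr b \<Rightarrow> (case q of Inl c \<Rightarrow> C $ b $ c | Inr d \<Rightarrow> D $ b $ d))"

definition kronecker ::
  "real ^ 'b::finite ^ 'a::finite \<Rightarrow> real ^ 'd::finite ^ 'c::finite
    \<Rightarrow> real ^ ('b \<times> 'd) ^ ('a \<times> 'c)" where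
  "kronecker A B = (\<chi> p q. A $ fst p $ fst q * B $ snd p $ snd q)"

definition agent_diag :: "('N::finite \<Rightarrow> real) \<Rightarrow> ('N, 'n::finite) smat" where
  "agent_diag t = (\<chi> p q. if p = q then t (fst p) else 0)"

definition pos_semidef :: "real ^ 'a::finite ^ 'a \<Rightarrow> bool" where
  "pos_semidef A \<longleftrightarrow> transpose A = A \<and> (\<forall>x. 0 \<le> x \<bullet> (A *v x))"

definition psd_sqrt :: "real ^ 'a::finite ^ 'a \<Rightarrow> real ^ 'a ^ 'a" where
  "psd_sqrt A = (THE B. pos_semidef B \<and> B ** B = A)"

definition singular_values :: "real ^ 'a::finite ^ 'b::finite \<Rightarrow> real set" where
  "singular_values A =
     {s. 0 \<le> s \<and> (\<exists>v. v \<noteq> 0 \<and> (transpose A ** A) *v v = s\<^sup>2 *\<^sub>R v)}"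

text \<open>
  The zero matrix has no nonzero singular value; inserting \<open>0\<close> below only fixes
  \<open>sigma_max 0 = 0\<close>, which is needed for a network with a single agent.
\<close>

definition sigma_max :: "real ^ 'a::finite ^ 'b::finite \<Rightarrow> real" where
  "sigma_max A = Max (insert 0 (singular_values A - {0}))"

definition sigma_min :: "real ^ 'a::finite ^ 'b::finite \<Rightarrow> real" where
  "sigma_min A = Min (singular_values A - {0})"

definition wnorm :: "real ^ 'a::finite ^ 'a \<Rightarrow> real ^ 'a \<Rightarrow> real" where
  "wnorm H z = sqrt (z \<bullet> (H *v z))"

definition wdist :: "real ^ 'a::finite ^ 'a \<Rightarrow> real ^ 'a \<Rightarrow> (real ^ 'a) set \<Rightarrow> real" where
  "wdist H z D = (INF z'\<in>D. wnorm H (z - z'))"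

definition ext_epigraph :: "('a \<Rightarrow> ereal) \<Rightarrow> ('a \<times> real) set" where
  "ext_epigraph g = {(x, r). g x \<le> ereal r}"

definition proper_closed_convex :: "('a::euclidean_space \<Rightarrow> ereal) \<Rightarrow> bool" where
  "proper_closed_convex g \<longleftrightarrow>
     (\<forall>x. g x \<noteq> -\<infinity>) \<and> (\<exists>x. g x \<noteq> \<infinity>) \<and>
     closed (ext_epigraph g) \<and> convex (ext_epigraph g)"

text \<open>
  For proper \<open>g\<close> this is empty outside the effective domain, so membership of \<open>x\<close> in the
  domain need not be demanded separately.
\<close>

definition subdifferential :: "('a::real_inner \<Rightarrow> ereal) \<Rightarrow> 'a \<Rightarrow> 'a set" where
  "subdifferential g x = {s. \<forall>y. g x + ereal (s \<bullet> (y - x)) \<le> g y}"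

definition gradient :: "('a::real_inner \<Rightarrow> real) \<Rightarrow> 'a \<Rightarrow> 'a" where
  "gradient f x = (THE D. GDERIV f x :> D)"

definition smooth_fun :: "real \<Rightarrow> ('a::euclidean_space \<Rightarrow> real) \<Rightarrow> bool" where
  "smooth_fun L f \<longleftrightarrow> (\<forall>x. f differentiable (at x)) \<and> L-lipschitz_on UNIV (gradient f)"

definition prox :: "real ^ 'a::finite ^ 'a \<Rightarrow> (real ^ 'a \<Rightarrow> ereal) \<Rightarrow> real ^ 'a \<Rightarrow> real ^ 'a" where
  "prox H g x = arg_min (\<lambda>y. g y + ereal (1/2 * (wnorm H (y - x))\<^sup>2)) (\<lambda>_. True)"

text \<open>
  The distance to the empty set is \<open>\<infinity>\<close>, so points with \<open>\<Psi> u = {}\<close> impose no condition;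
  they are excluded explicitly because \<^const>\<open>infdist\<close> to the empty set is \<open>0\<close>.
\<close>

definition metrically_subregular ::
  "('a::metric_space \<Rightarrow> 'b::metric_space set) \<Rightarrow> 'a \<Rightarrow> 'b \<Rightarrow> bool" where
  "metrically_subregular \<Psi> ubar vbar \<longleftrightarrow>
     vbar \<in> \<Psi> ubar \<and>
     (\<exists>\<epsilon>>0. \<exists>\<kappa>\<ge>0. \<forall>u. dist u ubar < \<epsilon> \<and> \<Psi> u \<noteq> {} \<longrightarrow>
        infdist u {w. vbar \<in> \<Psi> w} \<le> \<kappa> * infdist vbar (\<Psi> u))"

definition converges_Q_linearly :: "(nat \<Rightarrow> real) \<Rightarrow> bool" where
  "converges_Q_linearly a \<longleftrightarrow>
     (\<exists>q. 0 < q \<and> q < 1 \<and> (\<forall>\<^sub>F k in sequentially. a (Suc k) \<le> q * a k))"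

definition connected_graph :: "('N::finite \<times> 'N) set \<Rightarrow> bool" where
  "connected_graph E \<longleftrightarrow> sym E \<and> (\<forall>i j. (i, j) \<in> E\<^sup>*)"

definition doubly_stochastic :: "real ^ 'N::finite ^ 'N \<Rightarrow> bool" where
  "doubly_stochastic W \<longleftrightarrow>
     (\<forall>i j. 0 \<le> W $ i $ j) \<and> (\<forall>i. (\<Sum>j\<in>UNIV. W $ i $ j) = 1) \<and>
     (\<forall>j. (\<Sum>i\<in>UNIV. W $ i $ j) = 1)"

definition mixing_matrix :: "('N::finite \<times> 'N) set \<Rightarrow> real ^ 'N ^ 'N \<Rightarrow> bool" where
  "mixing_matrix E W \<longleftrightarrow>
     transpose W = W \<and> doubly_stochastic W \<and>
     {v. (mat 1 - W) *v v = 0} = span {vec 1} \<and>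
     (\<forall>i j. if (i, j) \<notin> E \<and> i \<noteq> j then W $ i $ j = 0 \<and> W $ j $ i = 0 else 0 < W $ i $ j)"

text \<open>
  Finiteness is required because every point minimizes an objective that is identically \<open>\<infinity>\<close>.
\<close>

definition optimal_solution ::
  "('N::finite \<Rightarrow> real ^ 'n::finite \<Rightarrow> real) \<Rightarrow> ('N \<Rightarrow> real ^ 'n \<Rightarrow> ereal) \<Rightarrow> real ^ 'n \<Rightarrow> bool" where
  "optimal_solution f g x \<longleftrightarrow>
     is_arg_min (\<lambda>y. \<Sum>i\<in>UNIV. ereal (f i y) + g i y) (\<lambda>_. True) x \<and>
     (\<Sum>i\<in>UNIV. ereal (f i x) + g i x) \<noteq> \<infinity>"

definition stacked_sum ::
  "('N::finite \<Rightarrow> real ^ 'n::finite \<Rightarrow> 'c::comm_monoid_add) \<Rightarrow> ('N, 'n) svec \<Rightarrow> 'c" where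
  "stacked_sum h x = (\<Sum>i\<in>UNIV. h i (agent_block x i))"

definition lagrangian ::
  "(real ^ 'a::finite \<Rightarrow> real) \<Rightarrow> (real ^ 'a \<Rightarrow> ereal) \<Rightarrow> real ^ 'a ^ 'a
    \<Rightarrow> real ^ 'a \<Rightarrow> real ^ 'a \<Rightarrow> ereal" where
  "lagrangian F G V x \<alpha> = ereal (F x) + G x - ereal (\<alpha> \<bullet> (V *v x))"

definition saddle_points ::
  "(real ^ 'a::finite \<Rightarrow> real) \<Rightarrow> (real ^ 'a \<Rightarrow> ereal) \<Rightarrow> real ^ 'a ^ 'a
    \<Rightarrow> (real ^ ('a + 'a)) set" where
  "saddle_points F G V = {u. \<forall>x \<alpha>.
     lagrangian F G V (upper u) \<alpha> \<le> lagrangian F G V (upper u) (lower u) \<and>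
     lagrangian F G V (upper u) (lower u) \<le> lagrangian F G V x (lower u)}"

definition kkt_map ::
  "(real ^ 'a::finite \<Rightarrow> real) \<Rightarrow> (real ^ 'a \<Rightarrow> ereal) \<Rightarrow> real ^ 'a ^ 'a
    \<Rightarrow> real ^ ('a + 'a) \<Rightarrow> (real ^ ('a + 'a)) set" where
  "kkt_map F G V u =
     {col (s + gradient F (upper u) - V *v lower u) (V *v upper u) | s.
        s \<in> subdifferential G (upper u)}"

text \<open>
  \<open>(xt, \<alpha>t)\<close> are the predictors, \<open>d\<close> the residuals of the inexact proximal steps, and
  \<open>x 0\<close> is unconstrained.
\<close>

definition D_iPGM ::
  "(real ^ 'a::finite \<Rightarrow> real) \<Rightarrow> (real ^ 'a \<Rightarrow> ereal) \<Rightarrow> real ^ 'a ^ 'a \<Rightarrow> real ^ 'a ^ 'a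
    \<Rightarrow> real \<Rightarrow> real ^ ('a + 'a) ^ ('a + 'a) \<Rightarrow> (nat \<Rightarrow> real ^ 'a)
    \<Rightarrow> (nat \<Rightarrow> real ^ 'a) \<Rightarrow> (nat \<Rightarrow> real ^ 'a) \<Rightarrow> (nat \<Rightarrow> real ^ 'a) \<Rightarrow> (nat \<Rightarrow> real ^ 'a)
    \<Rightarrow> bool" where
  "D_iPGM F G V \<Gamma> \<beta> M d x \<alpha> xt \<alpha>t \<longleftrightarrow>
     \<alpha> 0 = 0 \<and>
     (\<forall>k.
        xt k = prox (matrix_inv \<Gamma>) G (x k - \<Gamma> *v (gradient F (x k) - V *v \<alpha> k - d k)) \<and>
        \<alpha>t k = \<alpha> k - \<beta> *\<^sub>R (V *v xt k) \<and>
        col (x (Suc k)) (\<alpha> (Suc k)) =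
          col (x k) (\<alpha> k) - M *v (col (x k) (\<alpha> k) - col (xt k) (\<alpha>t k)))"

end

theory Submission
  imports Defs
begin

text \<open>
  Let \<open>u\<^sup>+\<close> be the iterate obtained from \<open>u\<close> by an exact step and \<open>e\<close> the gap between \<open>u\<close> and the
  exact prediction. Monotonicity of \<open>\<partial>G\<close> and cocoercivity of \<open>\<nabla>F\<close> give, for every saddle point \<open>w\<close>,
  \<open>\<parallel>u\<^sup>+ - w\<parallel>\<^sub>H\<^sup>2 \<le> \<parallel>u - w\<parallel>\<^sub>H\<^sup>2 - \<langle>e, H\<^sub>1 e\<rangle>\<close>. The prediction carries a KKT residual of size \<open>O(\<parallel>e\<parallel>)\<close>, so
  metric subregularity bounds the distance of \<open>u\<close> to the saddle points by a multiple of \<open>\<parallel>e\<parallel>\<close>, and an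
  exact step contracts that distance. Nonexpansiveness of the proximal map bounds the effect of
  the error \<open>d\<close> by \<open>\<mu>bar \<parallel>d\<parallel>\<close>, and \<open>H \<ge> H\<^sub>1 \<ge> c2\<^sup>2 I\<close> turns this into \<open>\<mu> \<rho> \<parallel>u - u'\<parallel>\<^sub>H\<close> for the inexact
  iterate \<open>u'\<close>.
\<close>

section \<open>Symmetric matrices and singular values\<close>

text \<open>The proximal step supplies a subgradient at the prediction, not at \<open>u\<close>, so
  this is where a KKT residual is at hand and where subregularity is applied. The Fejer inequality
  bounds \<open>e\<close> by a multiple of the distance from \<open>u\<close> to the limit point,
  itself a saddle point, hence the prediction stays in the neighbourhood. Returning from the
  prediction to \<open>u\<close> costs one more multiple of \<open>e\<close>: this is the
  \<open>+ 1\<close> in \<open>\<kappa> * \<kappa>2 * c1 + 1\<close>. Cocoercivity loses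
  \<open>L / 4\<close>, and the Fejer inequality uses it twice, whence the half of \<open>LF\<close>
  subtracted in \<open>H1\<close>. The map \<open>psd_sqrt H\<close> makes
  \<open>H\<close>-distances Euclidean, so comparing the exact with the inexact step becomes a
  statement about three points and a set in a metric space. The error is relative to the length of
  the inexact step itself; bounding that length by the triangle inequality means solving for it,
  which produces the denominator \<open>1 - \<mu> * \<rho> k\<close>.\<close>

lemma inner_matrix_vector_transpose:
  fixes A :: "real ^ 'a::finite ^ 'b::finite"
  shows "x \<bullet> (A *v y) = (transpose A *v x) \<bullet> y"
  by (simp add: dot_lmul_matrix)

lemma symmetric_inner:
  fixes A :: "real ^ 'a::finite ^ 'a"
  assumes "transpose A = A"
  shows "x \<bullet> (A *v y) = (A *v x) \<bullet> y"
  using inner_matrix_vector_transpose[of x A y] assms by simp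

text \<open>For small \<open>t\<close> a positive linear term outweighs any quadratic one. The next
  lemma uses this to read off stationarity from nonnegativity of a form.\<close>

lemma linear_le_quadratic_imp_nonpos:
  fixes a c :: real
  assumes "\<And>t. t > 0 \<Longrightarrow> t * a \<le> t\<^sup>2 * c"
  shows "a \<le> 0"
proof (rule ccontr)
  assume "\<not> a \<le> 0"
  then have a: "a > 0" by simp
  \<comment> \<open>Chosen so that, after division by \<open>t\<close>, the right-hand side is at
    most \<open>a / 2\<close>.\<close>
  define t where "t = a / (\<bar>c\<bar> + 1) / 2"
  have t: "t > 0" using a by (simp add: t_def)
  have "a \<le> t * c" using assms[OF t] t by (simp add: power2_eq_square)
  also have "\<dots> \<le> t * (\<bar>c\<bar> + 1)" using t by (intro mult_left_mono) auto
  also have "\<dots> = a / 2" by (simp add: t_def field_simps)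
  finally show False using a by simp
qed

text \<open>On \<open>S\<close> the form has its minimum 0 at \<open>v\<close>, so a move along
  \<open>- A *v v\<close> cannot lower it to first order. Invariance of \<open>S\<close> keeps that
  move inside \<open>S\<close>.\<close>

lemma psd_on_kernel:
  fixes A :: "real ^ 'a::finite ^ 'a"
  assumes sym: "transpose A = A"
    and S: "subspace S" "\<And>x. x \<in> S \<Longrightarrow> A *v x \<in> S"
    and psd: "\<And>x. x \<in> S \<Longrightarrow> 0 \<le> x \<bullet> (A *v x)"
    and v: "v \<in> S" "v \<bullet> (A *v v) = 0"
  shows "A *v v = 0"
proof -
  define w where "w = A *v v"
  have "t * (2 * (w \<bullet> w)) \<le> t\<^sup>2 * (w \<bullet> (A *v w))" for t :: real
  proof -
    have "v - t *\<^sub>R w \<in> S"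
      using S v by (simp add: w_def subspace_diff subspace_scale)
    then have "0 \<le> (v - t *\<^sub>R w) \<bullet> (A *v (v - t *\<^sub>R w))" by (rule psd)
    also have "\<dots> = - (t * (2 * (w \<bullet> w))) + t\<^sup>2 * (w \<bullet> (A *v w))"
      using v(2) symmetric_inner[OF sym, of v w]
      by (simp add: matrix_vector_mult_diff_distrib matrix_vector_mult_scaleR inner_diff_left
          inner_diff_right power2_eq_square algebra_simps flip: w_def)
    finally show ?thesis by simp
  qed
  then have "2 * (w \<bullet> w) \<le> 0" by (rule linear_le_quadratic_imp_nonpos)
  then have "w \<bullet> w = 0" using inner_ge_zero[of w] by linarith
  then show ?thesis by (simp add: w_def)
qed

text \<open>Let \<open>v\<close> maximise the Rayleigh quotient on the unit sphere of
  \<open>S\<close>, with value \<open>l\<close>. Then the form of \<open>l I - A\<close> is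
  nonnegative on \<open>S\<close> and vanishes at \<open>v\<close>, and \<open>psd_on_kernel\<close>
  puts \<open>v\<close> into its kernel.\<close>

lemma symmetric_eigenvector_on_subspace:
  fixes A :: "real ^ 'a::finite ^ 'a"
  assumes sym: "transpose A = A"
    and S: "subspace S" "\<And>x. x \<in> S \<Longrightarrow> A *v x \<in> S" and ne: "S \<noteq> {0}"
  obtains v l where "v \<in> S" "norm v = 1" "A *v v = l *\<^sub>R v"
proof -
  define K where "K = S \<inter> sphere 0 1"
  have "compact K" unfolding K_def
    using S(1) by (intro closed_Int_compact closed_subspace) auto
  moreover have "K \<noteq> {}"
  proof -
    obtain x where "x \<in> S" "x \<noteq> 0" using ne S(1) subspace_0 by fastforce
    then have "(1 / norm x) *\<^sub>R x \<in> K" using S(1) by (simp add: K_def subspace_scale)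
    then show ?thesis by auto
  qed
  moreover have "continuous_on K (\<lambda>x. x \<bullet> (A *v x))" by (intro continuous_intros)
  ultimately obtain v where v: "v \<in> K" and vmax: "\<And>x. x \<in> K \<Longrightarrow> x \<bullet> (A *v x) \<le> v \<bullet> (A *v v)"
    using continuous_attains_sup[of K "\<lambda>x. x \<bullet> (A *v x)"] by blast
  define l where "l = v \<bullet> (A *v v)"
  define P where "P = l *\<^sub>R mat 1 - A"
  have P: "P *v x = l *\<^sub>R x - A *v x" for x
    by (simp add: P_def matrix_vector_mult_diff_rdistrib scaleR_matrix_vector_assoc[symmetric])
  have "P *v v = 0"
  proof (rule psd_on_kernel[OF _ S(1)])
    show "transpose P = P"
      using sym by (simp add: P_def transpose_def vec_eq_iff mat_def)
    show "v \<in> S" "v \<bullet> (P *v v) = 0"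
      using v by (auto simp: K_def P inner_diff_right l_def dot_square_norm)
    fix x assume x: "x \<in> S"
    then show "P *v x \<in> S" using S by (simp add: P subspace_diff subspace_scale)
    show "0 \<le> x \<bullet> (P *v x)"
    proof (cases "x = 0")
      case False
      have "(1 / norm x) *\<^sub>R x \<in> K" using S(1) x False by (simp add: K_def subspace_scale)
      from vmax[OF this] have "x \<bullet> (A *v x) / (norm x)\<^sup>2 \<le> l"
        by (simp add: l_def matrix_vector_mult_scaleR power2_eq_square)
      then show ?thesis
        using False by (simp add: P inner_diff_right dot_square_norm field_simps)
    qed simp
  qed
  then have "A *v v = l *\<^sub>R v" by (simp add: P)
  with that v show ?thesis by (auto simp: K_def)
qed

text \<open>Induction on the dimension: by symmetry of \<open>A\<close>, the part of
  \<open>S\<close> orthogonal to an eigenvector is again invariant.\<close>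

lemma symmetric_eigenbasis_on_subspace:
  fixes A :: "real ^ 'a::finite ^ 'a"
  assumes sym: "transpose A = A"
  shows "subspace S \<Longrightarrow> (\<And>x. x \<in> S \<Longrightarrow> A *v x \<in> S) \<Longrightarrow>
    \<exists>B. B \<subseteq> S \<and> S \<subseteq> span B \<and> pairwise orthogonal B \<and>
      (\<forall>b\<in>B. norm b = 1 \<and> A *v b = (b \<bullet> (A *v b)) *\<^sub>R b)"
proof (induction "dim S" arbitrary: S rule: less_induct)
  case less
  show ?case
  proof (cases "S = {0}")
    case True
    then show ?thesis by (intro exI[of _ "{}"]) auto
  next
    case False
    then obtain v l where v: "v \<in> S" "norm v = 1" "A *v v = l *\<^sub>R v"
      using symmetric_eigenvector_on_subspace[OF sym less.prems] by blast
    have l: "v \<bullet> (A *v v) = l" using v by (simp add: dot_square_norm)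
    define T where "T = S \<inter> {x. v \<bullet> x = 0}"
    have T: "subspace T" unfolding T_def
      using less.prems(1) by (intro subspace_inter subspace_hyperplane)
    have "v \<notin> T" using v by (simp add: T_def dot_square_norm)
    moreover have "T \<subseteq> S" by (auto simp: T_def)
    ultimately have "T \<subset> S" using v(1) by blast
    then have "dim T < dim S"
      using T less.prems(1) by (metis dim_psubset span_eq_iff)
    moreover have "A *v x \<in> T" if "x \<in> T" for x
      using that less.prems(2) v(3) by (simp add: T_def symmetric_inner[OF sym])
    ultimately obtain B where B: "B \<subseteq> T" "T \<subseteq> span B" "pairwise orthogonal B"
      "\<forall>b\<in>B. norm b = 1 \<and> A *v b = (b \<bullet> (A *v b)) *\<^sub>R b"
      using less.hyps[OF _ T] by blast
    have "x \<in> span (insert v B)" if "x \<in> S" for x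
    proof -
      have "x - (v \<bullet> x) *\<^sub>R v \<in> T"
        using that v less.prems(1)
        by (simp add: T_def subspace_diff subspace_scale inner_diff_right dot_square_norm)
      then have "x - (v \<bullet> x) *\<^sub>R v \<in> span B" using B by blast
      then show ?thesis by (subst span_breakdown_eq) blast
    qed
    moreover have "pairwise orthogonal (insert v B)"
      using B(1,3) by (auto simp: pairwise_insert T_def orthogonal_def inner_commute)
    moreover have "insert v B \<subseteq> S" using B(1) v by (auto simp: T_def)
    ultimately show ?thesis using B v l
      by (intro exI[of _ "insert v B"]) auto
  qed
qed

text \<open>The eigenvalue of a unit vector \<open>b\<close> is written
  \<open>b \<bullet> (A *v b)\<close>, so no separate map from basis vectors to eigenvalues has to
  be carried along.\<close>

definition eigenbasis :: "real ^ 'a::finite ^ 'a \<Rightarrow> (real ^ 'a) set \<Rightarrow> bool" where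
  "eigenbasis A B \<longleftrightarrow> finite B \<and> pairwise orthogonal B \<and> span B = UNIV \<and>
     (\<forall>b\<in>B. norm b = 1 \<and> A *v b = (b \<bullet> (A *v b)) *\<^sub>R b)"

lemma symmetric_eigenbasis_exists:
  fixes A :: "real ^ 'a::finite ^ 'a"
  assumes "transpose A = A"
  obtains B where "eigenbasis A B"
proof -
  obtain B where B: "UNIV \<subseteq> span B" "pairwise orthogonal B"
      "\<forall>b\<in>B. norm b = 1 \<and> A *v b = (b \<bullet> (A *v b)) *\<^sub>R b"
    using symmetric_eigenbasis_on_subspace[OF assms, of UNIV] by auto
  then have "finite B" by (intro pairwise_orthogonal_imp_finite)
  with B that show ?thesis unfolding eigenbasis_def by blast
qed

lemma eigenbasis_expand:
  assumes "eigenbasis A B"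
  shows "(\<Sum>b\<in>B. (x \<bullet> b) *\<^sub>R b) = x"
  using assms unfolding eigenbasis_def by (intro orthonormal_basis_expand) auto

lemma eigenbasis_mult:
  assumes "eigenbasis A B"
  shows "A *v x = (\<Sum>b\<in>B. ((b \<bullet> (A *v b)) * (x \<bullet> b)) *\<^sub>R b)"
proof -
  have "A *v x = (\<Sum>b\<in>B. (x \<bullet> b) *\<^sub>R (A *v b))"
    using eigenbasis_expand[OF assms, of x]
    by (metis (no_types, lifting) matrix_vector_mul_linear linear_sum linear_scale sum.cong)
  also have "\<dots> = (\<Sum>b\<in>B. ((b \<bullet> (A *v b)) * (x \<bullet> b)) *\<^sub>R b)"
    using assms unfolding eigenbasis_def
    by (intro sum.cong refl) (metis mult.commute scaleR_scaleR)
  finally show ?thesis .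
qed

lemma eigenbasis_quadratic_form:
  assumes "eigenbasis A B"
  shows "x \<bullet> (A *v x) = (\<Sum>b\<in>B. (b \<bullet> (A *v b)) * (x \<bullet> b)\<^sup>2)"
  using arg_cong[OF eigenbasis_mult[OF assms, of x], of "(\<bullet>) x"]
  by (simp add: inner_sum_right power2_eq_square mult.assoc)

lemma eigenbasis_norm:
  assumes "eigenbasis A B"
  shows "(norm x)\<^sup>2 = (\<Sum>b\<in>B. (x \<bullet> b)\<^sup>2)"
proof -
  have "x \<bullet> x = x \<bullet> (\<Sum>b\<in>B. (x \<bullet> b) *\<^sub>R b)" by (simp add: eigenbasis_expand[OF assms])
  then show ?thesis by (simp add: inner_sum_right power2_eq_square dot_square_norm)
qed

text \<open>Some basis vector has a nonzero component along \<open>v\<close>; moving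
  \<open>A\<close> across the inner product of the two forces their eigenvalues to agree. Hence the
  basis misses no eigenvalue.\<close>

lemma eigenbasis_eigenvalue:
  assumes "eigenbasis A B" "v \<noteq> 0" "A *v v = l *\<^sub>R v" "transpose A = A"
  obtains b where "b \<in> B" "b \<bullet> (A *v b) = l"
proof -
  obtain b where b: "b \<in> B" "v \<bullet> b \<noteq> 0"
    using eigenbasis_expand[OF assms(1), of v] assms(2)
    by (metis (no_types, lifting) scale_eq_0_iff sum.neutral)
  have "l * (v \<bullet> b) = (b \<bullet> (A *v b)) * (v \<bullet> b)"
    using symmetric_inner[OF assms(4), of v b] assms(1,3) b(1)
    unfolding eigenbasis_def by (metis inner_scaleR_left inner_scaleR_right)
  with b that show ?thesis by auto
qed

lemma eigenbasis_nonempty: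
  assumes "eigenbasis (A :: real ^ 'a::finite ^ 'a) B"
  shows "B \<noteq> {}"
proof
  assume "B = {}"
  then have "(UNIV :: (real ^ 'a) set) = {0}" using assms by (simp add: eigenbasis_def)
  then have "(1 :: real ^ 'a) = 0" by blast
  then show False by simp
qed

section \<open>Singular values through the Gram matrix\<close>

lemma transpose_gram: "transpose (transpose A ** A) = transpose A ** A"
  for A :: "real ^ 'a::finite ^ 'b::finite"
  by (simp add: matrix_transpose_mul)

lemma inner_gram: "x \<bullet> ((transpose A ** A) *v y) = (A *v x) \<bullet> (A *v y)"
  for A :: "real ^ 'a::finite ^ 'b::finite"
  using inner_matrix_vector_transpose[of x "transpose A" "A *v y"]
  by (simp flip: matrix_vector_mul_assoc)

text \<open>The eigenvalue of the Gram matrix at \<open>b\<close> is the square of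
  \<open>norm (A *v b)\<close>. The resulting finiteness is what gives \<open>Max\<close> and
  \<open>Min\<close> in \<open>sigma_max\<close> and \<open>sigma_min\<close> their meaning.\<close>

lemma singular_values_eigenbasis:
  fixes A :: "real ^ 'a::finite ^ 'b::finite"
  assumes "eigenbasis (transpose A ** A) B"
  shows "singular_values A = (\<lambda>b. norm (A *v b)) ` B"
proof (intro equalityI subsetI)
  fix s assume "s \<in> singular_values A"
  then obtain v where v: "0 \<le> s" "v \<noteq> 0" "(transpose A ** A) *v v = s\<^sup>2 *\<^sub>R v"
    by (auto simp: singular_values_def)
  obtain b where b: "b \<in> B" "b \<bullet> ((transpose A ** A) *v b) = s\<^sup>2"
    using eigenbasis_eigenvalue[OF assms v(2,3) transpose_gram] .
  then have "(norm (A *v b))\<^sup>2 = s\<^sup>2" by (simp add: inner_gram dot_square_norm)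
  with v(1) b(1) show "s \<in> (\<lambda>b. norm (A *v b)) ` B" by auto
next
  fix s assume "s \<in> (\<lambda>b. norm (A *v b)) ` B"
  then obtain b where b: "b \<in> B" "s = norm (A *v b)" by auto
  have "norm b = 1" "(transpose A ** A) *v b = (b \<bullet> ((transpose A ** A) *v b)) *\<^sub>R b"
    using assms b(1) by (auto simp: eigenbasis_def)
  then have "(transpose A ** A) *v b = s\<^sup>2 *\<^sub>R b" "b \<noteq> 0"
    using b(2) unfolding inner_gram dot_square_norm by auto
  then show "s \<in> singular_values A"
    using b(2) unfolding singular_values_def by auto
qed

lemma finite_singular_values: "finite (singular_values A)"
  for A :: "real ^ 'a::finite ^ 'b::finite"
proof -
  obtain B where B: "eigenbasis (transpose A ** A) B"
    using symmetric_eigenbasis_exists[OF transpose_gram] .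
  then show ?thesis using singular_values_eigenbasis[OF B] by (simp add: eigenbasis_def)
qed

lemma sigma_max_nonneg: "0 \<le> sigma_max A"
  unfolding sigma_max_def by (simp add: finite_singular_values)

lemma norm_le_sigma_max: "norm (A *v x) \<le> sigma_max A * norm x"
  for A :: "real ^ 'a::finite ^ 'b::finite"
proof -
  obtain B where B: "eigenbasis (transpose A ** A) B"
    using symmetric_eigenbasis_exists[OF transpose_gram] .
  have "(norm (A *v x))\<^sup>2 = x \<bullet> ((transpose A ** A) *v x)"
    by (simp add: inner_gram dot_square_norm)
  also have "\<dots> = (\<Sum>b\<in>B. (norm (A *v b))\<^sup>2 * (x \<bullet> b)\<^sup>2)"
    by (subst eigenbasis_quadratic_form[OF B]) (simp add: inner_gram dot_square_norm)
  also have "\<dots> \<le> (\<Sum>b\<in>B. (sigma_max A)\<^sup>2 * (x \<bullet> b)\<^sup>2)"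
  proof (intro sum_mono mult_right_mono power_mono)
    fix b assume "b \<in> B"
    \<comment> \<open>The inserted 0 accounts for basis vectors in the kernel of
      \<open>A\<close>.\<close>
    then have "norm (A *v b) \<in> insert 0 (singular_values A - {0})"
      using singular_values_eigenbasis[OF B] by auto
    then show "norm (A *v b) \<le> sigma_max A"
      unfolding sigma_max_def by (intro Max_ge) (auto simp: finite_singular_values)
  qed auto
  also have "\<dots> = (sigma_max A * norm x)\<^sup>2"
    by (simp add: power_mult_distrib eigenbasis_norm[OF B] sum_distrib_left)
  finally show ?thesis
    by (rule power2_le_imp_le) (simp add: sigma_max_nonneg)
qed

lemma quadratic_form_le_sigma_max: "x \<bullet> (A *v x) \<le> sigma_max A * (norm x)\<^sup>2"
  for A :: "real ^ 'a::finite ^ 'a"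
proof -
  have "x \<bullet> (A *v x) \<le> norm x * norm (A *v x)" by (rule norm_cauchy_schwarz)
  also have "\<dots> \<le> norm x * (sigma_max A * norm x)"
    by (intro mult_left_mono norm_le_sigma_max) auto
  finally show ?thesis by (simp add: power2_eq_square algebra_simps)
qed

text \<open>All eigenvalues are positive, so each of them is a nonzero singular value and discarding
  0 in \<open>sigma_min\<close> loses no direction.\<close>

lemma positive_definite_sigma_min:
  fixes A :: "real ^ 'a::finite ^ 'a"
  assumes sym: "transpose A = A" and pos: "\<And>x. x \<noteq> 0 \<Longrightarrow> 0 < x \<bullet> (A *v x)"
  shows sigma_min_pos: "0 < sigma_min A"
    and sigma_min_le_quadratic_form: "sigma_min A * (norm x)\<^sup>2 \<le> x \<bullet> (A *v x)"
proof -
  obtain B where B: "eigenbasis A B" using symmetric_eigenbasis_exists[OF sym] .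
  have sv: "b \<bullet> (A *v b) \<in> singular_values A - {0}" if "b \<in> B" for b
  proof -
    have b: "norm b = 1" "A *v b = (b \<bullet> (A *v b)) *\<^sub>R b"
      using B that by (auto simp: eigenbasis_def)
    define l where "l = b \<bullet> (A *v b)"
    have "A *v b = l *\<^sub>R b" using b(2) by (simp add: l_def)
    then have "(transpose A ** A) *v b = l\<^sup>2 *\<^sub>R b"
      by (simp add: sym matrix_vector_mult_scaleR power2_eq_square flip: matrix_vector_mul_assoc)
    moreover have "b \<noteq> 0" using b(1) by auto
    moreover have "l > 0" using pos[OF \<open>b \<noteq> 0\<close>] by (simp add: l_def)
    ultimately show ?thesis unfolding l_def[symmetric] singular_values_def by auto
  qed
  have fin: "finite (singular_values A - {0})" by (simp add: finite_singular_values)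
  have ne: "singular_values A - {0} \<noteq> {}" using sv eigenbasis_nonempty[OF B] by blast
  show "0 < sigma_min A"
    unfolding sigma_min_def using fin ne
    by (subst Min_gr_iff) (auto simp: singular_values_def)
  have "(\<Sum>b\<in>B. sigma_min A * (x \<bullet> b)\<^sup>2) \<le> (\<Sum>b\<in>B. (b \<bullet> (A *v b)) * (x \<bullet> b)\<^sup>2)"
    unfolding sigma_min_def using fin sv by (intro sum_mono mult_right_mono Min_le) auto
  then show "sigma_min A * (norm x)\<^sup>2 \<le> x \<bullet> (A *v x)"
    by (subst eigenbasis_quadratic_form[OF B])
      (simp add: eigenbasis_norm[OF B] sum_distrib_left)
qed

section \<open>Positive semidefinite square roots and the weighted distance\<close>

lemma symmetric_eq_0:
  fixes A :: "real ^ 'a::finite ^ 'a"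
  assumes "transpose A = A" "\<And>v l. A *v v = l *\<^sub>R v \<Longrightarrow> A *v v = 0"
  shows "A = 0"
proof -
  obtain B where B: "eigenbasis A B" using symmetric_eigenbasis_exists[OF assms(1)] .
  have "A *v b = 0" if "b \<in> B" for b
  proof (rule assms(2))
    show "A *v b = (b \<bullet> (A *v b)) *\<^sub>R b"
      using B that unfolding eigenbasis_def by blast
  qed
  then have "A *v x = 0" for x by (subst eigenbasis_mult[OF B]) simp
  then show ?thesis by (simp add: matrix_eq)
qed

lemma pos_semidef_kernel:
  assumes "pos_semidef A" "v \<bullet> (A *v v) = 0"
  shows "A *v v = 0"
  using assms psd_on_kernel[of A UNIV v] by (auto simp: pos_semidef_def)

text \<open>With \<open>D = B - C\<close> one has \<open>B D + D C = 0\<close>, so an eigenvector of \<open>D\<close> for a nonzero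
  eigenvalue is annihilated by both quadratic forms, hence by \<open>D\<close>.\<close>
lemma psd_sqrt_unique:
  assumes B: "pos_semidef B" and C: "pos_semidef C" and eq: "B ** B = C ** C"
  shows "B = C"
proof -
  define D where "D = B - C"
  have Dv: "D *v v = B *v v - C *v v" for v by (simp add: D_def matrix_vector_mult_diff_rdistrib)
  have sym: "transpose D = D"
    using B C by (simp add: D_def pos_semidef_def transpose_def vec_eq_iff)
  have "D *v v = 0" if v: "D *v v = l *\<^sub>R v" for v l
  proof (cases "l = 0")
    case True then show ?thesis using v by simp
  next
    case False
    have "B *v (D *v v) + D *v (C *v v) = (B ** B) *v v - (C ** C) *v v"
      by (simp add: Dv matrix_vector_mult_diff_distrib flip: matrix_vector_mul_assoc)
    then have "v \<bullet> (B *v (D *v v)) + v \<bullet> (D *v (C *v v)) = 0"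
      using eq by (simp add: inner_add_right[symmetric])
    then have "l * (v \<bullet> (B *v v) + v \<bullet> (C *v v)) = 0"
      using v by (simp add: symmetric_inner[OF sym, of v] matrix_vector_mult_scaleR algebra_simps)
    moreover have "v \<bullet> (B *v v) \<ge> 0" "v \<bullet> (C *v v) \<ge> 0"
      using B C by (auto simp: pos_semidef_def)
    ultimately have "v \<bullet> (B *v v) = 0" "v \<bullet> (C *v v) = 0" using False by auto
    then have "B *v v = 0" "C *v v = 0" using B C pos_semidef_kernel by auto
    then show ?thesis by (simp add: Dv)
  qed
  then have "D = 0" using symmetric_eq_0[OF sym] by blast
  then show ?thesis by (simp add: D_def)
qed

text \<open>The root keeps an eigenbasis of \<open>A\<close> and replaces each eigenvalue by its
  square root.\<close>

lemma psd_sqrt_exists: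
  assumes "pos_semidef A"
  obtains R where "pos_semidef R" "R ** R = A"
proof -
  have sym: "transpose A = A" and psd: "\<And>x. 0 \<le> x \<bullet> (A *v x)"
    using assms by (auto simp: pos_semidef_def)
  obtain B where B: "eigenbasis A B" using symmetric_eigenbasis_exists[OF sym] .
  have fB: "finite B" and orth: "pairwise orthogonal B" and nB: "\<And>b. b \<in> B \<Longrightarrow> norm b = 1"
    using B by (auto simp: eigenbasis_def)
  define r where "r x = (\<Sum>b\<in>B. (sqrt (b \<bullet> (A *v b)) * (x \<bullet> b)) *\<^sub>R b)" for x
  have lin: "linear r"
    unfolding r_def
    by (intro linearI)
      (simp_all add: inner_add_left algebra_simps sum.distrib scaleR_sum_right)
  define R where "R = matrix r"
  have R: "R *v x = r x" for x by (simp add: R_def matrix_works lin)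
  have rb: "r b = sqrt (b \<bullet> (A *v b)) *\<^sub>R b" if "b \<in> B" for b
  proof -
    have "r b = (\<Sum>b'\<in>B. if b' = b then sqrt (b \<bullet> (A *v b)) *\<^sub>R b else 0)"
      unfolding r_def using orth nB[OF that] that
      by (intro sum.cong refl) (auto simp: pairwise_def orthogonal_def dot_square_norm)
    then show ?thesis using fB that by simp
  qed
  have sR: "x \<bullet> (R *v y) = (R *v x) \<bullet> y" for x y
    by (simp add: R r_def inner_sum_right inner_sum_left inner_commute mult_ac)
  have "transpose R = R"
  proof -
    have "(transpose R *v x) \<bullet> y = (R *v x) \<bullet> y" for x y
      using sR inner_matrix_vector_transpose[of x R y] by simp
    then show ?thesis by (metis matrix_eq vector_eq_rdot)
  qed
  moreover have "0 \<le> x \<bullet> (R *v x)" for x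
    unfolding R r_def inner_sum_right
    by (intro sum_nonneg) (simp add: psd mult.assoc zero_le_mult_iff zero_le_square)
  moreover have "R ** R = A"
  proof -
    have "(R ** R) *v x = A *v x" for x
    proof -
      have "(R ** R) *v x = r (r x)" by (simp add: R flip: matrix_vector_mul_assoc)
      also have "\<dots> = (\<Sum>b\<in>B. (sqrt (b \<bullet> (A *v b)) * (x \<bullet> b)) *\<^sub>R r b)"
        by (subst (2) r_def) (simp add: linear_sum[OF lin] linear_scale[OF lin])
      also have "\<dots> = (\<Sum>b\<in>B. ((b \<bullet> (A *v b)) * (x \<bullet> b)) *\<^sub>R b)"
        by (intro sum.cong refl) (simp add: rb psd mult_ac flip: real_sqrt_mult)
      also have "\<dots> = A *v x" by (rule eigenbasis_mult[OF B, symmetric])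
      finally show ?thesis .
    qed
    then show ?thesis by (simp add: matrix_eq)
  qed
  ultimately show ?thesis using that by (auto simp: pos_semidef_def)
qed

lemma psd_sqrt:
  assumes "pos_semidef A"
  shows pos_semidef_psd_sqrt: "pos_semidef (psd_sqrt A)"
    and psd_sqrt_square: "psd_sqrt A ** psd_sqrt A = A"
proof -
  have "\<exists>!R. pos_semidef R \<and> R ** R = A"
    using psd_sqrt_exists[OF assms] psd_sqrt_unique by metis
  from theI'[OF this] show "pos_semidef (psd_sqrt A)" "psd_sqrt A ** psd_sqrt A = A"
    unfolding psd_sqrt_def by auto
qed

lemma wnorm_psd_sqrt:
  assumes "pos_semidef H"
  shows "wnorm H z = norm (psd_sqrt H *v z)"
proof -
  have "transpose (psd_sqrt H) = psd_sqrt H"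
    using pos_semidef_psd_sqrt[OF assms] by (simp add: pos_semidef_def)
  then have "z \<bullet> (H *v z) = (psd_sqrt H *v z) \<bullet> (psd_sqrt H *v z)"
    using inner_gram[of z "psd_sqrt H" z] psd_sqrt_square[OF assms] by simp
  then show ?thesis by (simp add: wnorm_def norm_eq_sqrt_inner)
qed

lemma wnorm_square:
  assumes "pos_semidef H"
  shows "(wnorm H z)\<^sup>2 = z \<bullet> (H *v z)"
  using assms by (simp add: wnorm_def pos_semidef_def)

text \<open>The root of \<open>H\<close> carries the weighted distance to a Euclidean one, where the
  triangle inequality for \<open>infdist\<close> is at hand. For empty \<open>D\<close> the two
  sides would be governed by unrelated conventions.\<close>

lemma wdist_eq_infdist:
  assumes "pos_semidef H" "D \<noteq> {}"
  shows "wdist H z D = infdist (psd_sqrt H *v z) ((*v) (psd_sqrt H) ` D)"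
proof -
  have "infdist (psd_sqrt H *v z) ((*v) (psd_sqrt H) ` D)
      = (INF z'\<in>D. dist (psd_sqrt H *v z) (psd_sqrt H *v z'))"
    using assms(2) by (simp only: infdist_notempty image_is_empty not_False_eq_True image_image)
  also have "\<dots> = wdist H z D"
    by (simp only: wdist_def wnorm_psd_sqrt[OF assms(1)] dist_norm matrix_vector_mult_diff_distrib)
  finally show ?thesis ..
qed

section \<open>Convex analysis\<close>

lemma gradient_eq:
  assumes "GDERIV f x :> D"
  shows "gradient f x = D"
  unfolding gradient_def
proof (rule the_equality[of "\<lambda>D. GDERIV f x :> D", OF assms])
  fix D' assume "GDERIV f x :> D'"
  with assms have "(\<lambda>h. h \<bullet> D') = (\<lambda>h. h \<bullet> D)"
    unfolding gderiv_def by (rule has_derivative_unique[rotated])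
  then show "D' = D" by (metis vector_eq_ldot)
qed

text \<open>The gradient is the Riesz representative of the derivative, obtained as its adjoint
  applied to 1.\<close>

lemma differentiable_imp_GDERIV:
  fixes f :: "'a::euclidean_space \<Rightarrow> real"
  assumes "f differentiable (at x)"
  shows "GDERIV f x :> gradient f x"
proof -
  obtain f' where f': "(f has_derivative f') (at x)" using assms by (auto simp: differentiable_def)
  have "linear f'" using f' has_derivative_linear by blast
  then have "f' = (\<lambda>h. h \<bullet> adjoint f' 1)" by (simp add: adjoint_works fun_eq_iff)
  with f' have "GDERIV f x :> adjoint f' 1" unfolding gderiv_def by metis
  then show ?thesis using gradient_eq by metis
qed

lemma GDERIV_along_line:
  assumes "GDERIV f (x + t *\<^sub>R h) :> D"
  shows "((\<lambda>t. f (x + t *\<^sub>R h)) has_field_derivative D \<bullet> h) (at t)"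
proof -
  have "((\<lambda>t. x + t *\<^sub>R h) has_derivative (\<lambda>s. s *\<^sub>R h)) (at t)"
    by (auto intro!: derivative_eq_intros)
  from has_derivative_compose[OF this assms[unfolded gderiv_def]]
  show ?thesis
    unfolding has_field_derivative_def
    by (rule has_derivative_eq_rhs) (simp add: fun_eq_iff inner_commute)
qed

lemma convex_on_gradient_inequality:
  fixes f :: "'a::real_inner \<Rightarrow> real"
  assumes conv: "convex_on UNIV f" and D: "GDERIV f x :> D"
  shows "f x + D \<bullet> (y - x) \<le> f y"
proof -
  let ?p = "\<lambda>t. f (x + t *\<^sub>R (y - x))"
  have "convex_on UNIV ?p"
  proof (rule convex_onI)
    fix t a b :: real assume t: "0 < t" "t < 1"
    have "x + ((1 - t) *\<^sub>R a + t *\<^sub>R b) *\<^sub>R (y - x)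
        = (1 - t) *\<^sub>R (x + a *\<^sub>R (y - x)) + t *\<^sub>R (x + b *\<^sub>R (y - x))"
      by (simp add: algebra_simps)
    then show "?p ((1 - t) *\<^sub>R a + t *\<^sub>R b) \<le> (1 - t) * ?p a + t * ?p b"
      using convex_onD[OF conv, of t "x + a *\<^sub>R (y - x)" "x + b *\<^sub>R (y - x)"] t by simp
  qed auto
  moreover have "(?p has_field_derivative D \<bullet> (y - x)) (at 0)"
    by (rule GDERIV_along_line) (simp add: D)
  ultimately have "?p 1 - ?p 0 \<ge> (D \<bullet> (y - x)) * (1 - 0)"
    by (intro convex_on_imp_above_tangent[where A = UNIV]) auto
  then show ?thesis by simp
qed

lemma smooth_fun_GDERIV: "smooth_fun L f \<Longrightarrow> GDERIV f x :> gradient f x"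
  by (simp add: smooth_fun_def differentiable_imp_GDERIV)

lemma smooth_fun_Lipschitz:
  assumes "smooth_fun L f"
  shows "norm (gradient f x - gradient f y) \<le> L * norm (x - y)"
  using assms by (auto simp: smooth_fun_def dist_norm dest: lipschitz_onD)

text \<open>The descent lemma without an integral: the function \<open>?p\<close> is nonincreasing
  on [0, 1], because Cauchy-Schwarz and the Lipschitz condition make its derivative
  nonpositive.\<close>

lemma smooth_fun_upper_bound:
  fixes f :: "'a::euclidean_space \<Rightarrow> real"
  assumes f: "smooth_fun L f"
  shows "f y \<le> f x + gradient f x \<bullet> (y - x) + L / 2 * (norm (y - x))\<^sup>2"
proof -
  define h where "h = y - x"
  let ?p = "\<lambda>t. f (x + t *\<^sub>R h) - t * (gradient f x \<bullet> h) - L / 2 * t\<^sup>2 * (norm h)\<^sup>2"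
  have "?p 1 \<le> ?p 0"
  proof (rule DERIV_nonpos_imp_nonincreasing[of 0 1 ?p])
    fix t :: real assume t: "0 \<le> t" "t \<le> 1"
    let ?D = "gradient f (x + t *\<^sub>R h) \<bullet> h - gradient f x \<bullet> h - L * t * (norm h)\<^sup>2"
    have "(?p has_field_derivative ?D) (at t)"
      by (rule derivative_eq_intros GDERIV_along_line smooth_fun_GDERIV[OF f] refl)+ simp
    moreover have "?D \<le> 0"
    proof -
      have "(gradient f (x + t *\<^sub>R h) - gradient f x) \<bullet> h
          \<le> norm (gradient f (x + t *\<^sub>R h) - gradient f x) * norm h"
        by (rule norm_cauchy_schwarz)
      also have "\<dots> \<le> (L * (t * norm h)) * norm h"
        using smooth_fun_Lipschitz[OF f, of "x + t *\<^sub>R h" x] t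
        by (intro mult_right_mono) auto
      finally show ?thesis by (simp add: inner_diff_left power2_eq_square mult_ac)
    qed
    ultimately show "\<exists>y. (?p has_field_derivative y) (at t) \<and> y \<le> 0" by blast
  qed simp
  then show ?thesis by (simp add: h_def)
qed

text \<open>The Baillon--Haddad theorem: \<open>f - \<langle>\<nabla>f(x), \<cdot>\<rangle>\<close> is minimal at \<open>x\<close>, and a gradient step
  from \<open>y\<close> decreases it by \<open>\<parallel>\<nabla>f(y) - \<nabla>f(x)\<parallel>\<^sup>2 / (2L)\<close>.\<close>
lemma smooth_convex_cocoercive:
  fixes f :: "'a::euclidean_space \<Rightarrow> real"
  assumes f: "smooth_fun L f" and conv: "convex_on UNIV f" and L: "0 < L"
  shows "(norm (gradient f x - gradient f y))\<^sup>2 / L \<le> (gradient f x - gradient f y) \<bullet> (x - y)"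
proof -
  have half: "f x + gradient f x \<bullet> (y - x) + (norm (gradient f y - gradient f x))\<^sup>2 / (2 * L) \<le> f y"
    for x y
  proof -
    define d where "d = gradient f y - gradient f x"
    define z where "z = y - (1 / L) *\<^sub>R d"
    have "f x + gradient f x \<bullet> (z - x) \<le> f z"
      by (rule convex_on_gradient_inequality[OF conv smooth_fun_GDERIV[OF f]])
    also have "f z \<le> f y + gradient f y \<bullet> (z - y) + L / 2 * (norm (z - y))\<^sup>2"
      by (rule smooth_fun_upper_bound[OF f])
    finally have *: "f x + gradient f x \<bullet> (z - x)
      \<le> f y + gradient f y \<bullet> (z - y) + L / 2 * (norm (z - y))\<^sup>2" .
    have "gradient f x \<bullet> (z - x) = gradient f x \<bullet> (y - x) - (1 / L) * (gradient f x \<bullet> d)"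
      by (simp add: z_def inner_diff_right)
    moreover have "gradient f y \<bullet> (z - y) = - (1 / L) * (gradient f y \<bullet> d)"
      by (simp add: z_def)
    moreover have "L / 2 * (norm (z - y))\<^sup>2 = (norm d)\<^sup>2 / (2 * L)"
      using L by (simp add: z_def power2_eq_square field_simps)
    moreover have "gradient f y \<bullet> d - gradient f x \<bullet> d = (norm d)\<^sup>2"
      by (simp add: d_def power2_norm_eq_inner inner_diff_left)
    then have "(1 / L) * (gradient f y \<bullet> d) - (1 / L) * (gradient f x \<bullet> d) = (norm d)\<^sup>2 / L"
      using L by (simp add: field_simps)
    ultimately have "f x + gradient f x \<bullet> (y - x) + (norm d)\<^sup>2 / L \<le> f y + (norm d)\<^sup>2 / (2 * L)"
      using * by linarith
    moreover have "(norm d)\<^sup>2 / L = (norm d)\<^sup>2 / (2 * L) + (norm d)\<^sup>2 / (2 * L)"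
      using L by (simp add: field_simps)
    ultimately show ?thesis by (simp add: d_def)
  qed
  have "(norm (gradient f x - gradient f y))\<^sup>2 / L
      = (norm (gradient f y - gradient f x))\<^sup>2 / (2 * L)
        + (norm (gradient f x - gradient f y))\<^sup>2 / (2 * L)"
    using L by (simp add: norm_minus_commute field_simps)
  then show ?thesis
    using half[of x y] half[of y x] by (simp add: inner_diff_left inner_diff_right)
qed

text \<open>Cocoercivity between \<open>x\<close> and \<open>z\<close> pays for replacing
  \<open>x\<close> by \<open>y\<close>: the cross term is absorbed by completing a square, at the
  price of \<open>L / 4\<close>. In the algorithm \<open>x\<close> is the current point,
  \<open>y\<close> the prediction and \<open>z\<close> a solution.\<close>

lemma smooth_convex_three_point:
  fixes f :: "'a::euclidean_space \<Rightarrow> real"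
  assumes "smooth_fun L f" "convex_on UNIV f" "0 < L"
  shows "- (L / 4) * (norm (x - y))\<^sup>2 \<le> (y - z) \<bullet> (gradient f x - gradient f z)"
proof -
  define d where "d = gradient f x - gradient f z"
  have 1: "(norm d)\<^sup>2 / L \<le> d \<bullet> (x - z)"
    unfolding d_def by (rule smooth_convex_cocoercive[OF assms])
  have 2: "(x - y) \<bullet> d \<le> norm (x - y) * norm d" by (rule norm_cauchy_schwarz)
  have "0 \<le> (norm d - L / 2 * norm (x - y))\<^sup>2 / L" using assms(3) by simp
  also have "\<dots> = (norm d)\<^sup>2 / L - norm (x - y) * norm d + L / 4 * (norm (x - y))\<^sup>2"
    using assms(3) by (simp add: power2_eq_square field_simps)
  finally have "- (L / 4) * (norm (x - y))\<^sup>2 \<le> d \<bullet> (x - z) - (x - y) \<bullet> d" using 1 2 by linarith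
  also have "\<dots> = (y - z) \<bullet> d" by (simp add: inner_diff_left inner_diff_right inner_commute)
  finally show ?thesis by (simp add: d_def)
qed

section \<open>Proximal points and subgradients\<close>

lemma proper_closed_convex_le:
  assumes "proper_closed_convex g" "g x = ereal a" "g y = ereal b" "0 \<le> t" "t \<le> 1"
  shows "g ((1 - t) *\<^sub>R x + t *\<^sub>R y) \<le> ereal ((1 - t) * a + t * b)"
proof -
  have "(1 - t) *\<^sub>R (x, a) + t *\<^sub>R (y, b) \<in> ext_epigraph g"
    using assms by (intro convexD) (auto simp: proper_closed_convex_def ext_epigraph_def)
  then show ?thesis by (simp add: ext_epigraph_def)
qed

text \<open>With the finite term \<open>q\<close> moved to the right, the set is a continuous
  preimage of the epigraph.\<close>

lemma proper_closed_convex_closed_sublevel: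
  fixes g :: "'a::euclidean_space \<Rightarrow> ereal"
  assumes "proper_closed_convex g" "continuous_on UNIV q"
  shows "closed {y. g y + ereal (q y) \<le> ereal r}"
proof -
  have "closed ((\<lambda>y. (y, r - q y)) -` ext_epigraph g)"
    using assms
    by (intro closed_vimage continuous_on_Pair continuous_intros)
      (auto simp: proper_closed_convex_def)
  moreover have "g y + ereal (q y) \<le> ereal r \<longleftrightarrow> g y \<le> ereal (r - q y)" for y
    by (cases "g y") auto
  ultimately show ?thesis by (simp add: ext_epigraph_def vimage_def)
qed

text \<open>Weierstrass for lower semicontinuous functions: the sublevel sets above the infimum have
  the finite intersection property on \<open>K\<close>, and a common point attains the
  infimum.\<close>

lemma compact_attains_inf_ereal:
  fixes \<phi> :: "'a::topological_space \<Rightarrow> ereal"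
  assumes "compact K" "K \<noteq> {}" and cl: "\<And>r. closed {y. \<phi> y \<le> ereal r}"
  obtains y where "y \<in> K" "\<And>z. z \<in> K \<Longrightarrow> \<phi> y \<le> \<phi> z"
proof -
  define I where "I = Inf (\<phi> ` K)"
  have "K \<inter> (\<Inter>r\<in>{r. I < ereal r}. {y. \<phi> y \<le> ereal r}) \<noteq> {}"
  proof (rule compact_imp_fip_image[OF assms(1) cl])
    fix R assume R: "finite R" "R \<subseteq> {r. I < ereal r}"
    show "K \<inter> (\<Inter>r\<in>R. {y. \<phi> y \<le> ereal r}) \<noteq> {}"
    proof (cases "R = {}")
      case False
      then have "Min R \<in> R" using R by simp
      then have "I < ereal (Min R)" using R by auto
      then obtain z where z: "z \<in> K" "\<phi> z < ereal (Min R)"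
        unfolding I_def Inf_less_iff by auto
      have "\<phi> z \<le> ereal r" if "r \<in> R" for r
        using z(2) Min_le[OF R(1) that] by (meson ereal_less_eq(3) less_le_trans less_imp_le)
      with z(1) show ?thesis by blast
    qed (use assms in auto)
  qed
  then obtain y where y: "y \<in> K" "\<And>r. I < ereal r \<Longrightarrow> \<phi> y \<le> ereal r" by auto
  have "\<phi> y \<le> I"
  proof (rule ccontr)
    assume "\<not> \<phi> y \<le> I"
    then obtain r where "I < ereal r" "ereal r < \<phi> y" using ereal_dense2 by (metis not_le)
    then show False using y(2) by fastforce
  qed
  then show ?thesis using that y(1) unfolding I_def by (meson INF_lower order_trans)
qed

text \<open>Convexity lets \<open>g\<close> fall at most linearly away from a point
  \<open>x0\<close> of its domain, so the quadratic term dominates outside a large ball and the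
  search becomes compact.\<close>

lemma proper_closed_convex_prox_exists:
  fixes g :: "'a::euclidean_space \<Rightarrow> ereal"
  assumes g: "proper_closed_convex g" and c: "0 < c"
  obtains p where "\<And>y. g p + ereal (c * (norm (p - x))\<^sup>2) \<le> g y + ereal (c * (norm (y - x))\<^sup>2)"
proof -
  have nMInf: "g y \<noteq> -\<infinity>" for y using g by (simp add: proper_closed_convex_def)
  obtain x0 a where x0: "g x0 = ereal a"
    using g nMInf unfolding proper_closed_convex_def by (metis ereal_cases)
  obtain z where z: "z \<in> cball x0 1" "\<And>y. y \<in> cball x0 1 \<Longrightarrow> g z \<le> g y"
  proof (rule compact_attains_inf_ereal[of "cball x0 1" g])
    show "closed {y. g y \<le> ereal r}" for r
      using proper_closed_convex_closed_sublevel[OF g, of "\<lambda>_. 0" r]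
      by (simp add: zero_ereal_def[symmetric])
  qed auto
  have "g z \<le> ereal a" using z(2)[of x0] x0 by simp
  then obtain m where m: "g z = ereal m" "m \<le> a" using nMInf[of z] by (cases "g z") auto
  define K where "K = a - m"
  have K: "K \<ge> 0" using m by (simp add: K_def)
  have lower: "m - norm (y - x0) * K \<le> b" if b: "g y = ereal b" for y b
  proof (cases "norm (y - x0) \<le> 1")
    case True
    then have "m \<le> b" using z(2)[of y] m b by (simp add: dist_norm norm_minus_commute)
    moreover have "0 \<le> norm (y - x0) * K" using K by simp
    ultimately show ?thesis by linarith
  next
    case False
    define R where "R = norm (y - x0)"
    have R: "R > 1" using False by (simp add: R_def)
    \<comment> \<open>The point where the segment from \<open>x0\<close> to \<open>y\<close> leaves
      the unit ball; there \<open>m\<close> is a lower bound, and convexity carries it on to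
      \<open>y\<close>.\<close>
    define w where "w = (1 - 1 / R) *\<^sub>R x0 + (1 / R) *\<^sub>R y"
    have "w - x0 = (1 / R) *\<^sub>R (y - x0)" by (simp add: w_def algebra_simps)
    then have "norm (w - x0) = 1" using R by (simp add: R_def[symmetric])
    then have "ereal m \<le> g w"
      using z(2)[of w] m by (simp add: dist_norm norm_minus_commute)
    also have "g w \<le> ereal ((1 - 1 / R) * a + (1 / R) * b)"
      unfolding w_def using R by (intro proper_closed_convex_le[OF g x0 b]) auto
    finally have "R * m \<le> R * ((1 - 1 / R) * a + (1 / R) * b)"
      using R by (intro mult_left_mono) auto
    also have "\<dots> = (R - 1) * a + b" using R by (simp add: field_simps)
    finally have "m - R * K + K \<le> b" by (simp add: K_def algebra_simps)
    then show ?thesis using K by (simp add: R_def)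
  qed
  define \<psi> where "\<psi> y = g y + ereal (c * (norm (y - x))\<^sup>2)" for y
  define r0 where "r0 = norm (x - x0)"
  \<comment> \<open>For \<open>R > R0\<close> one needs
    \<open>K + R * K + 2 * c * R * r0 \<le> c * R\<^sup>2\<close>. The terms \<open>2 * r0\<close>
    and \<open>2 * K / c\<close> give this once \<open>K \<le> R * K\<close>, which the summand 1
    guarantees.\<close>
  define R0 where "R0 = 1 + 2 * r0 + 2 * K / c"
  have R0: "R0 \<ge> 1" using K c by (simp add: R0_def r0_def)
  obtain p where p: "p \<in> cball x0 R0" "\<And>y. y \<in> cball x0 R0 \<Longrightarrow> \<psi> p \<le> \<psi> y"
  proof (rule compact_attains_inf_ereal[of "cball x0 R0" \<psi>])
    show "closed {y. \<psi> y \<le> ereal r}" for r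
      unfolding \<psi>_def
      by (intro proper_closed_convex_closed_sublevel[OF g] continuous_intros)
  qed (use R0 in auto)
  have "\<psi> p \<le> \<psi> y" for y
  proof (cases "y \<in> cball x0 R0")
    case False
    define R where "R = norm (y - x0)"
    have R: "R > R0" using False by (simp add: R_def dist_norm norm_minus_commute)
    have px0: "\<psi> p \<le> \<psi> x0" using p(2) R0 by simp
    show ?thesis
    proof (cases "g y")
      case (real b)
      have "R - r0 \<le> norm (y - x)"
        using norm_triangle_ineq[of "y - x" "x - x0"] by (simp add: R_def r0_def)
      moreover have Rr: "0 \<le> R - r0"
        using R K c by (simp add: R0_def r0_def) (smt (verit) divide_nonneg_pos norm_ge_zero)
      ultimately have sq: "(R - r0)\<^sup>2 \<le> (norm (y - x))\<^sup>2" by (intro power_mono)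
      have "2 * r0 + 2 * K / c \<le> R" using R by (simp add: R0_def)
      then have "c * (2 * r0 + 2 * K / c) \<le> c * R" using c by (intro mult_left_mono) auto
      then have "2 * c * r0 + 2 * K \<le> c * R" using c by (simp add: algebra_simps)
      then have "R * (2 * c * r0 + 2 * K) \<le> R * (c * R)" using R R0 by (intro mult_left_mono) auto
      moreover have "K \<le> R * K" using K R R0 by (simp add: mult_le_cancel_right1)
      ultimately have "a + c * r0\<^sup>2 \<le> m - R * K + c * (R - r0)\<^sup>2"
        by (simp add: K_def power2_eq_square algebra_simps)
      also have "\<dots> \<le> b + c * (norm (y - x))\<^sup>2"
        using lower[OF real] sq c by (simp add: R_def add_mono)
      finally have "\<psi> x0 \<le> \<psi> y"
        using real x0 by (simp add: \<psi>_def r0_def norm_minus_commute)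
      with px0 show ?thesis by order
    qed (use nMInf in \<open>auto simp: \<psi>_def\<close>)
  qed (use p in auto)
  then show ?thesis using that unfolding \<psi>_def by blast
qed

text \<open>Fermat's rule for a differentiable plus a convex function: compare \<open>p\<close> with
  points on the segment to \<open>y\<close> and let them tend to \<open>p\<close>. Convexity of
  \<open>G\<close> is asked for at finite values, the form in which it is proved for stacked
  sums.\<close>

lemma subdifferential_minimum:
  fixes G :: "'a::euclidean_space \<Rightarrow> ereal"
  assumes conv: "\<And>x y a b t. \<lbrakk>G x = ereal a; G y = ereal b; 0 \<le> t; t \<le> 1\<rbrakk>
      \<Longrightarrow> G ((1 - t) *\<^sub>R x + t *\<^sub>R y) \<le> ereal ((1 - t) * a + t * b)"
    and proper: "\<And>x. G x \<noteq> -\<infinity>" "\<exists>x. G x \<noteq> \<infinity>"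
    and D: "GDERIV \<phi> p :> D"
    and min: "\<And>y. ereal (\<phi> p) + G p \<le> ereal (\<phi> y) + G y"
  shows "- D \<in> subdifferential G p"
proof -
  obtain x0 where "G x0 \<noteq> \<infinity>" using proper by blast
  then have "G p \<noteq> \<infinity>" using min[of x0] by (cases "G x0") auto
  then obtain a where a: "G p = ereal a" using proper(1)[of p] by (cases "G p") auto
  have "G p + ereal (- D \<bullet> (y - p)) \<le> G y" for y
  proof (cases "G y")
    case (real b)
    define q where "q t = (\<phi> (p + t *\<^sub>R (y - p)) - \<phi> p) / t" for t
    have ge: "a - b \<le> q t" if t: "0 < t" "t < 1" for t
    proof -
      have "ereal (\<phi> p + a) \<le> ereal (\<phi> (p + t *\<^sub>R (y - p))) + G (p + t *\<^sub>R (y - p))"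
        using min[of "p + t *\<^sub>R (y - p)"] a by simp
      also have "p + t *\<^sub>R (y - p) = (1 - t) *\<^sub>R p + t *\<^sub>R y" by (simp add: algebra_simps)
      also have "ereal (\<phi> ((1 - t) *\<^sub>R p + t *\<^sub>R y)) + G ((1 - t) *\<^sub>R p + t *\<^sub>R y)
          \<le> ereal (\<phi> ((1 - t) *\<^sub>R p + t *\<^sub>R y)) + ereal ((1 - t) * a + t * b)"
        using t by (intro add_left_mono conv[OF a real]) auto
      also have "(1 - t) *\<^sub>R p + t *\<^sub>R y = p + t *\<^sub>R (y - p)" by (simp add: algebra_simps)
      finally have "t * (a - b) \<le> \<phi> (p + t *\<^sub>R (y - p)) - \<phi> p" by (simp add: algebra_simps)
      then show ?thesis using t by (simp add: q_def field_simps)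
    qed
    have "((\<lambda>t. \<phi> (p + t *\<^sub>R (y - p))) has_field_derivative D \<bullet> (y - p)) (at 0)"
      by (rule GDERIV_along_line) (simp add: D)
    then have "(q \<longlongrightarrow> D \<bullet> (y - p)) (at 0)"
      by (simp add: has_field_derivative_iff q_def[abs_def])
    then have "(q \<longlongrightarrow> D \<bullet> (y - p)) (at_right 0)" by (rule filterlim_at_split[THEN iffD1, THEN conjunct2])
    moreover have "eventually (\<lambda>t. a - b \<le> q t) (at_right 0)"
      unfolding eventually_at_right_field using ge by (intro exI[of _ 1]) auto
    ultimately have "a - b \<le> D \<bullet> (y - p)"
      by (rule tendsto_lowerbound) simp
    then show ?thesis using a real by simp
  qed (use proper in auto)
  then show ?thesis by (simp add: subdifferential_def)
qed

lemma subdifferential_monotone: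
  assumes "s \<in> subdifferential g x" "t \<in> subdifferential g y" "g x = ereal a" "g y = ereal b"
  shows "0 \<le> (s - t) \<bullet> (x - y)"
proof -
  have "g x + ereal (s \<bullet> (y - x)) \<le> g y" "g y + ereal (t \<bullet> (x - y)) \<le> g x"
    using assms(1,2) by (auto simp: subdifferential_def)
  then show ?thesis using assms(3,4) by (simp add: inner_diff_left inner_diff_right)
qed

section \<open>Stacked vectors and the mixing matrix\<close>

definition stack :: "('N::finite \<Rightarrow> real ^ 'n::finite) \<Rightarrow> ('N, 'n) svec" where
  "stack v = (\<chi> p. v (fst p) $ snd p)"

lemma agent_block_stack [simp]: "agent_block (stack v) i = v i"
  by (simp add: agent_block_def stack_def vec_eq_iff)

lemma stack_agent_block [simp]: "stack (agent_block x) = x"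
  by (simp add: agent_block_def stack_def vec_eq_iff)

lemma agent_block_eqI: "(\<And>i. agent_block x i = agent_block y i) \<Longrightarrow> x = y"
  by (metis ext stack_agent_block)

lemma agent_block_linear [simp]:
  "agent_block (x + y) i = agent_block x i + agent_block y i"
  "agent_block (x - y) i = agent_block x i - agent_block y i"
  "agent_block (- x) i = - agent_block x i"
  "agent_block (c *\<^sub>R x) i = c *\<^sub>R agent_block x i"
  "agent_block 0 i = 0"
  by (simp_all add: agent_block_def vec_eq_iff)

lemma agent_block_agent_diag [simp]: "agent_block (agent_diag t *v x) i = t i *\<^sub>R agent_block x i"
proof -
  have "(agent_diag t *v x) $ p = t (fst p) * x $ p" for p
  proof -
    have "(agent_diag t *v x) $ p = (\<Sum>q\<in>UNIV. if p = q then t (fst p) * x $ q else 0)"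
      unfolding matrix_vector_mult_def agent_diag_def
      by (simp add: if_distrib[of "\<lambda>c. c * _"] cong: if_cong)
    then show ?thesis by simp
  qed
  then show ?thesis by (simp add: agent_block_def vec_eq_iff)
qed

lemma inner_agent_block: "x \<bullet> y = (\<Sum>i\<in>UNIV. agent_block x i \<bullet> agent_block y i)"
  by (simp add: inner_vec_def agent_block_def sum.cartesian_product flip: UNIV_Times_UNIV)

lemma norm_agent_block: "(norm x)\<^sup>2 = (\<Sum>i\<in>UNIV. (norm (agent_block x i))\<^sup>2)"
  using inner_agent_block[of x x] by (simp add: dot_square_norm)

lemma inner_agent_diag: "x \<bullet> (agent_diag t *v y) = (\<Sum>i\<in>UNIV. t i * (agent_block x i \<bullet> agent_block y i))"
  by (simp add: inner_agent_block)

lemma symmetricI: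
  fixes A :: "real ^ 'a::finite ^ 'a"
  assumes "\<And>x y. x \<bullet> (A *v y) = y \<bullet> (A *v x)"
  shows "transpose A = A"
proof -
  have "(transpose A *v x) \<bullet> y = (A *v x) \<bullet> y" for x y
    using assms[of x y] inner_matrix_vector_transpose[of x A y] by (simp add: inner_commute)
  then show ?thesis by (metis matrix_eq vector_eq_rdot)
qed

lemma transpose_agent_diag: "transpose (agent_diag t) = agent_diag t"
  by (rule symmetricI) (simp add: inner_agent_diag inner_commute)

text \<open>\<open>matrix_inv\<close> is a choice among two-sided inverses; for square matrices a
  one-sided inverse already determines it.\<close>

lemma matrix_inv_eqI:
  fixes A B :: "real ^ 'a::finite ^ 'a"
  assumes "A ** B = mat 1"
  shows "matrix_inv A = B"
proof -
  have "B ** A = mat 1" using assms matrix_left_right_inverse by blast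
  with assms have "A ** matrix_inv A = mat 1 \<and> matrix_inv A ** A = mat 1"
    unfolding matrix_inv_def by (intro someI[of "\<lambda>C. A ** C = mat 1 \<and> C ** A = mat 1" B]) simp
  then show ?thesis by (metis assms matrix_mul_assoc matrix_mul_lid matrix_mul_rid)
qed

lemma matrix_inv_agent_diag:
  assumes "\<And>i. t i \<noteq> 0"
  shows "matrix_inv (agent_diag t :: ('a::finite, 'b::finite) smat) = agent_diag (\<lambda>i. 1 / t i)"
proof (rule matrix_inv_eqI)
  have "(agent_diag t ** agent_diag (\<lambda>i. 1 / t i)) *v x = x" for x :: "('a, 'b) svec"
    by (rule agent_block_eqI) (simp add: assms flip: matrix_vector_mul_assoc)
  then show "(agent_diag t :: ('a, 'b) smat) ** agent_diag (\<lambda>i. 1 / t i) = mat 1"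
    unfolding matrix_eq by simp
qed

section \<open>Separable smooth functions\<close>

lemma GDERIV_stacked_sum:
  assumes "\<And>i. GDERIV (f i) (agent_block x i) :> D i"
  shows "GDERIV (stacked_sum f) x :> stack D"
proof -
  have lin: "bounded_linear (\<lambda>x. agent_block x i)" for i
    by (intro linear_conv_bounded_linear[THEN iffD1] linearI) simp_all
  have "((\<lambda>x. f i (agent_block x i)) has_derivative (\<lambda>h. agent_block h i \<bullet> D i)) (at x)" for i
    using has_derivative_compose[OF bounded_linear_imp_has_derivative[OF lin] assms[unfolded gderiv_def]] .
  then show ?thesis
    unfolding gderiv_def stacked_sum_def inner_agent_block agent_block_stack
    by (intro has_derivative_sum)
qed

context
  fixes f :: "'N::finite \<Rightarrow> real ^ 'n::finite \<Rightarrow> real" and L :: "'N \<Rightarrow> real"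
  assumes smooth: "\<And>i. smooth_fun (L i) (f i)"
begin

lemma GDERIV_stacked_smooth: "GDERIV (stacked_sum f) x :> gradient (stacked_sum f) x"
  and agent_block_gradient: "agent_block (gradient (stacked_sum f) x) i = gradient (f i) (agent_block x i)"
proof -
  have D: "GDERIV (stacked_sum f) x :> stack (\<lambda>i. gradient (f i) (agent_block x i))"
    by (intro GDERIV_stacked_sum smooth_fun_GDERIV[OF smooth])
  then show "GDERIV (stacked_sum f) x :> gradient (stacked_sum f) x"
    "agent_block (gradient (stacked_sum f) x) i = gradient (f i) (agent_block x i)"
    by (simp_all add: gradient_eq)
qed

lemma stacked_smooth_Lipschitz:
  assumes "\<And>i. 0 \<le> L i" "\<And>i. L i \<le> K"
  shows "norm (gradient (stacked_sum f) x - gradient (stacked_sum f) y) \<le> K * norm (x - y)"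
proof (rule power2_le_imp_le)
  have K: "0 \<le> K" using assms order_trans by blast
  show "0 \<le> K * norm (x - y)" using K by simp
  show "(norm (gradient (stacked_sum f) x - gradient (stacked_sum f) y))\<^sup>2 \<le> (K * norm (x - y))\<^sup>2"
    unfolding norm_agent_block power_mult_distrib sum_distrib_left
  proof (rule sum_mono)
    fix i
    have "norm (gradient (f i) (agent_block x i) - gradient (f i) (agent_block y i))
        \<le> L i * norm (agent_block x i - agent_block y i)"
      by (rule smooth_fun_Lipschitz[OF smooth])
    also have "\<dots> \<le> K * norm (agent_block x i - agent_block y i)"
      using assms by (intro mult_right_mono) auto
    finally show "(norm (agent_block (gradient (stacked_sum f) x - gradient (stacked_sum f) y) i))\<^sup>2
        \<le> K\<^sup>2 * (norm (agent_block (x - y) i))\<^sup>2"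
      by (simp add: agent_block_gradient power_mono flip: power_mult_distrib)
  qed
qed

lemma stacked_gradient_inequality:
  assumes "\<And>i. convex_on UNIV (f i)"
  shows "stacked_sum f x + gradient (stacked_sum f) x \<bullet> (y - x) \<le> stacked_sum f y"
  unfolding stacked_sum_def[of f x] stacked_sum_def[of f y] inner_agent_block agent_block_gradient
    sum.distrib[symmetric] agent_block_linear
  by (intro sum_mono convex_on_gradient_inequality assms smooth_fun_GDERIV[OF smooth])

lemma stacked_three_point:
  assumes "\<And>i. convex_on UNIV (f i)" "\<And>i. 0 < L i"
  shows "- (1 / 4) * ((x - y) \<bullet> (agent_diag L *v (x - y)))
    \<le> (y - z) \<bullet> (gradient (stacked_sum f) x - gradient (stacked_sum f) z)"
proof -
  have "- (1 / 4) * ((x - y) \<bullet> (agent_diag L *v (x - y)))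
      = (\<Sum>i\<in>UNIV. - (L i / 4) * (norm (agent_block x i - agent_block y i))\<^sup>2)"
    by (simp add: inner_agent_diag dot_square_norm sum_distrib_left sum_negf)
  also have "\<dots> \<le> (\<Sum>i\<in>UNIV. (agent_block y i - agent_block z i)
        \<bullet> (gradient (f i) (agent_block x i) - gradient (f i) (agent_block z i)))"
    by (intro sum_mono smooth_convex_three_point smooth assms)
  also have "\<dots> = (y - z) \<bullet> (gradient (stacked_sum f) x - gradient (stacked_sum f) z)"
    by (simp add: inner_agent_block[of "y - z"] agent_block_gradient)
  finally show ?thesis .
qed

end

section \<open>Separable nonsmooth functions\<close>

context
  fixes g :: "'N::finite \<Rightarrow> real ^ 'n::finite \<Rightarrow> ereal"
  assumes pcc: "\<And>i. proper_closed_convex (g i)"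
begin

lemma block_not_MInf: "g i y \<noteq> -\<infinity>"
  using pcc[of i] by (simp add: proper_closed_convex_def)

lemma stacked_sum_ereal:
  assumes "\<And>i. g i (agent_block x i) = ereal (r i)"
  shows "stacked_sum g x = ereal (\<Sum>i\<in>UNIV. r i)"
  by (simp add: stacked_sum_def assms)

lemma stacked_sum_finiteE:
  assumes "stacked_sum g x \<noteq> \<infinity>"
  obtains r where "\<forall>i. g i (agent_block x i) = ereal (r i)" "stacked_sum g x = ereal (\<Sum>i\<in>UNIV. r i)"
proof -
  have "g i (agent_block x i) \<noteq> \<infinity>" for i
    using assms by (auto simp: stacked_sum_def sum_Pinfty)
  then have fin: "g i (agent_block x i) = ereal (real_of_ereal (g i (agent_block x i)))" for i
    using block_not_MInf[of i] by (cases "g i (agent_block x i)") auto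
  then show ?thesis using stacked_sum_ereal[OF fin] by (intro that allI)
qed

lemma stacked_sum_not_MInf: "stacked_sum g x \<noteq> -\<infinity>"
  by (cases "stacked_sum g x = \<infinity>") (auto elim: stacked_sum_finiteE)

lemma stacked_sum_proper: "\<exists>x. stacked_sum g x \<noteq> \<infinity>"
proof -
  have "\<exists>y. g i y \<noteq> \<infinity>" for i using pcc[of i] by (simp add: proper_closed_convex_def)
  then obtain y where "\<And>i. g i (y i) \<noteq> \<infinity>" by metis
  then have "stacked_sum g (stack y) \<noteq> \<infinity>" by (simp add: stacked_sum_def sum_Pinfty)
  then show ?thesis by blast
qed

lemma stacked_sum_convex:
  assumes "stacked_sum g x = ereal a" "stacked_sum g y = ereal b" "0 \<le> t" "t \<le> 1"
  shows "stacked_sum g ((1 - t) *\<^sub>R x + t *\<^sub>R y) \<le> ereal ((1 - t) * a + t * b)"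
proof -
  have fin: "stacked_sum g x \<noteq> \<infinity>" "stacked_sum g y \<noteq> \<infinity>" using assms(1,2) by simp_all
  obtain r where r: "\<forall>i. g i (agent_block x i) = ereal (r i)" "stacked_sum g x = ereal (\<Sum>i\<in>UNIV. r i)"
    using stacked_sum_finiteE[OF fin(1)] .
  obtain s where s: "\<forall>i. g i (agent_block y i) = ereal (s i)" "stacked_sum g y = ereal (\<Sum>i\<in>UNIV. s i)"
    using stacked_sum_finiteE[OF fin(2)] .
  have "stacked_sum g ((1 - t) *\<^sub>R x + t *\<^sub>R y) \<le> (\<Sum>i\<in>UNIV. ereal ((1 - t) * r i + t * s i))"
    unfolding stacked_sum_def agent_block_linear
    by (intro sum_mono proper_closed_convex_le[OF pcc r(1)[rule_format] s(1)[rule_format]] assms)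
  also have "\<dots> = ereal ((1 - t) * a + t * b)"
    using assms r(2) s(2) by (auto simp: sum.distrib simp flip: sum_distrib_left)
  finally show ?thesis .
qed

text \<open>Testing the subgradient inequality with a point that differs from \<open>x\<close> in
  block \<open>i\<close> alone isolates that block. The finite values come along because
  monotonicity of the blocks needs them.\<close>

lemma subdifferential_stacked_sum:
  assumes "s \<in> subdifferential (stacked_sum g) x"
  obtains r where "\<forall>i. g i (agent_block x i) = ereal (r i)"
    "\<forall>i. agent_block s i \<in> subdifferential (g i) (agent_block x i)"
proof -
  have sub: "stacked_sum g x + ereal (s \<bullet> (y - x)) \<le> stacked_sum g y" for y
    using assms by (simp add: subdifferential_def)
  have fin: "stacked_sum g x \<noteq> \<infinity>" using stacked_sum_proper sub by force
  obtain r where r: "\<forall>i. g i (agent_block x i) = ereal (r i)"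
      "stacked_sum g x = ereal (\<Sum>i\<in>UNIV. r i)"
    using stacked_sum_finiteE[OF fin] .
  have "g i (agent_block x i) + ereal (agent_block s i \<bullet> (z - agent_block x i)) \<le> g i z" for i z
  proof (cases "g i z")
    case (real b)
    define y where "y = stack ((agent_block x)(i := z))"
    have "stacked_sum g y = ereal (\<Sum>j\<in>UNIV. (r(i := b)) j)"
      by (intro stacked_sum_ereal) (auto simp: y_def r real)
    also have "(\<Sum>j\<in>UNIV. (r(i := b)) j) = (\<Sum>j\<in>UNIV. r j) + (b - r i)"
    proof -
      have "(\<Sum>j\<in>UNIV. (r(i := b)) j) - (\<Sum>j\<in>UNIV. r j) = (\<Sum>j\<in>UNIV. if j = i then b - r i else 0)"
        unfolding sum_subtractf[symmetric] by (intro sum.cong) auto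
      then show ?thesis by simp
    qed
    moreover have "s \<bullet> (y - x) = agent_block s i \<bullet> (z - agent_block x i)"
    proof -
      have "s \<bullet> (y - x)
          = (\<Sum>j\<in>UNIV. if j = i then agent_block s i \<bullet> (z - agent_block x i) else 0)"
        unfolding inner_agent_block by (intro sum.cong) (auto simp: y_def)
      then show ?thesis by simp
    qed
    ultimately show ?thesis using sub[of y] by (simp add: r real)
  qed (use block_not_MInf in auto)
  then show ?thesis by (intro that[OF r(1)]) (simp add: subdifferential_def)
qed

text \<open>Separability gives monotonicity under any nonnegative agentwise weights. Weight 1 serves
  the Fejer inequality, weight \<open>\<tau>\<close> the sensitivity of the proximal step.\<close>

lemma stacked_subdifferential_weighted_monotone:
  assumes "s \<in> subdifferential (stacked_sum g) x" "t \<in> subdifferential (stacked_sum g) y"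
    and "\<And>i. 0 \<le> w i"
  shows "0 \<le> (x - y) \<bullet> (agent_diag w *v (s - t))"
proof -
  obtain a where a: "\<forall>i. g i (agent_block x i) = ereal (a i)"
      "\<forall>i. agent_block s i \<in> subdifferential (g i) (agent_block x i)"
    using subdifferential_stacked_sum[OF assms(1)] .
  obtain b where b: "\<forall>i. g i (agent_block y i) = ereal (b i)"
      "\<forall>i. agent_block t i \<in> subdifferential (g i) (agent_block y i)"
    using subdifferential_stacked_sum[OF assms(2)] .
  show ?thesis
    unfolding inner_agent_diag agent_block_linear
    by (intro sum_nonneg mult_nonneg_nonneg assms(3))
      (subst inner_commute, rule subdifferential_monotone[OF a(2)[rule_format] b(2)[rule_format]
        a(1)[rule_format] b(1)[rule_format]])
qed

text \<open>A diagonal weight splits the proximal problem into one per agent, so a minimiser is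
  assembled blockwise; Fermat's rule then applies to the whole sum.\<close>

lemma stacked_prox_optimality:
  assumes c: "\<And>i. 0 < c i" and p_def: "p = prox (agent_diag c) (stacked_sum g) z"
  shows "agent_diag c *v (z - p) \<in> subdifferential (stacked_sum g) p"
proof -
  define \<phi> where "\<phi> y = 1 / 2 * ((y - z) \<bullet> (agent_diag c *v (y - z)))" for y
  have psd: "pos_semidef (agent_diag c)"
    by (auto simp: pos_semidef_def transpose_agent_diag inner_agent_diag intro!: sum_nonneg
        mult_nonneg_nonneg less_imp_le[OF c])
  have obj: "stacked_sum g y + ereal (1/2 * (wnorm (agent_diag c) (y - z))\<^sup>2)
      = ereal (\<phi> y) + stacked_sum g y" for y
    by (simp add: wnorm_square[OF psd] \<phi>_def add.commute)
  have sumobj: "ereal (\<phi> y) + stacked_sum g y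
      = (\<Sum>i\<in>UNIV. g i (agent_block y i) + ereal (c i / 2 * (norm (agent_block y i - agent_block z i))\<^sup>2))"
    for y
    by (simp add: stacked_sum_def sum.distrib \<phi>_def inner_agent_diag dot_square_norm
        sum_distrib_left add.commute)
  have "\<exists>q. \<forall>y. g i q + ereal (c i / 2 * (norm (q - agent_block z i))\<^sup>2)
      \<le> g i y + ereal (c i / 2 * (norm (y - agent_block z i))\<^sup>2)" for i
    using proper_closed_convex_prox_exists[OF pcc, of "c i / 2" i "agent_block z i"] c[of i]
    by (metis half_gt_zero)
  then obtain q where q: "\<And>i y. g i (q i) + ereal (c i / 2 * (norm (q i - agent_block z i))\<^sup>2)
      \<le> g i y + ereal (c i / 2 * (norm (y - agent_block z i))\<^sup>2)"
    by metis
  have "ereal (\<phi> (stack q)) + stacked_sum g (stack q) \<le> ereal (\<phi> y) + stacked_sum g y" for y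
    unfolding sumobj agent_block_stack by (intro sum_mono q)
  \<comment> \<open>\<open>prox\<close> is a choice by \<open>arg_min\<close>, which denotes a
    minimiser once one exists; \<open>stack q\<close> is the witness.\<close>
  then have min: "ereal (\<phi> p) + stacked_sum g p \<le> ereal (\<phi> y) + stacked_sum g y" for y
    unfolding p_def prox_def obj
    by (rule_tac x = "stack q" in arg_minI) (auto simp: not_less)
  have "GDERIV \<phi> p :> agent_diag c *v (p - z)"
  proof -
    have bl: "bounded_linear (\<lambda>x. agent_diag c *v x)" by (rule matrix_vector_mul_bounded_linear)
    have "((\<lambda>y. (y - z) \<bullet> (agent_diag c *v (y - z))) has_derivative
        (\<lambda>h. (p - z) \<bullet> (agent_diag c *v h) + h \<bullet> (agent_diag c *v (p - z)))) (at p)"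
      by (intro has_derivative_inner bounded_linear.has_derivative[OF bl])
        (auto intro!: derivative_eq_intros)
    from has_derivative_mult_right[OF this, of "1/2"]
    show ?thesis
      unfolding gderiv_def \<phi>_def[abs_def]
      by (rule has_derivative_eq_rhs)
        (simp add: fun_eq_iff inner_agent_diag inner_commute)
  qed
  then have "- (agent_diag c *v (p - z)) \<in> subdifferential (stacked_sum g) p"
    by (intro subdifferential_minimum[where \<phi> = \<phi>] stacked_sum_convex stacked_sum_not_MInf
        stacked_sum_proper min)
  moreover have "- (agent_diag c *v (p - z)) = agent_diag c *v (z - p)"
    by (simp add: matrix_vector_mult_diff_distrib)
  ultimately show ?thesis by simp
qed

end

section \<open>Primal-dual pairs and block matrices\<close>

lemma upper_col [simp]: "upper (col x y) = x" and lower_col [simp]: "lower (col x y) = y"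
  by (simp_all add: upper_def lower_def col_def vec_eq_iff)

lemma col_upper_lower [simp]: "col (upper u) (lower u) = u"
  by (simp add: upper_def lower_def col_def vec_eq_iff split: sum.split)

lemma col_eq_iff [simp]: "col x y = col x' y' \<longleftrightarrow> x = x' \<and> y = y'"
  by (metis lower_col upper_col)

lemma col_linear:
  "col x y + col x' y' = col (x + x') (y + y')"
  "col x y - col x' y' = col (x - x') (y - y')"
  by (simp_all add: col_def vec_eq_iff split: sum.split)

lemma col_0 [simp]: "col 0 0 = 0"
  by (simp add: col_def vec_eq_iff split: sum.split)

lemma upper_lower_diff [simp]:
  "upper (u - v) = upper u - upper v" "lower (u - v) = lower u - lower v"
  by (simp_all add: upper_def lower_def vec_eq_iff)

lemma sum_UNIV_Plus: "(\<Sum>p\<in>UNIV. h p) = (\<Sum>a\<in>UNIV. h (Inl a)) + (\<Sum>b\<in>UNIV. h (Inr b))"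
  for h :: "'a::finite + 'b::finite \<Rightarrow> 'c::comm_monoid_add"
  by (simp add: sum.Plus flip: UNIV_Plus_UNIV)

lemma inner_col: "col x y \<bullet> col x' y' = x \<bullet> x' + y \<bullet> y'"
  by (simp add: inner_vec_def col_def sum_UNIV_Plus)

lemma norm_col: "(norm (col x y))\<^sup>2 = (norm x)\<^sup>2 + (norm y)\<^sup>2"
  using inner_col[of x y x y] by (simp add: dot_square_norm)

lemma norm_col_le: "norm (col x y) \<le> norm x + norm y"
  by (rule power2_le_imp_le) (simp_all add: norm_col power2_sum)

lemma norm_le_norm_col: "norm x \<le> norm (col x y)" "norm y \<le> norm (col x y)"
  by (rule power2_le_imp_le; simp add: norm_col)+

lemma block_mat_col: "block_mat A B C D *v col x y = col (A *v x + B *v y) (C *v x + D *v y)"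
  by (simp add: vec_eq_iff matrix_vector_mult_def block_mat_def col_def sum_UNIV_Plus split: sum.split)

lemma mat_scale_vector: "mat c *v x = c *\<^sub>R x" for x :: "real ^ 'a::finite"
proof -
  have "(mat c *v x) $ p = (\<Sum>q\<in>UNIV. if p = q then c * x $ q else 0)" for p
    unfolding matrix_vector_mult_def mat_def
    by (simp add: if_distrib[of "\<lambda>c. c * _"] cong: if_cong)
  then show ?thesis by (simp add: vec_eq_iff)
qed

section \<open>Spectral bounds from the mixing matrix\<close>

lemma agent_block_kronecker:
  "agent_block (kronecker W (mat 1) *v x) i = (\<Sum>j\<in>UNIV. W $ i $ j *\<^sub>R agent_block x j)"
proof -
  have "(\<Sum>q\<in>UNIV. W $ i $ fst q * mat 1 $ k $ snd q * x $ q) = (\<Sum>j\<in>UNIV. W $ i $ j * x $ (j, k))" for k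
  proof -
    have "(\<Sum>q\<in>UNIV. W $ i $ fst q * mat 1 $ k $ snd q * x $ q)
        = (\<Sum>j\<in>UNIV. \<Sum>l\<in>UNIV. W $ i $ j * mat 1 $ k $ l * x $ (j, l))"
      by (simp add: sum.cartesian_product split_def flip: UNIV_Times_UNIV)
    also have "\<dots> = (\<Sum>j\<in>UNIV. \<Sum>l\<in>UNIV. if k = l then W $ i $ j * x $ (j, l) else 0)"
      by (intro sum.cong refl) (simp add: mat_def)
    finally show ?thesis by simp
  qed
  then show ?thesis
    by (simp add: agent_block_def kronecker_def matrix_vector_mult_def vec_eq_iff)
qed

text \<open>One identity for both ends of the spectrum of \<open>I - W\<close>: the last term on the
  left vanishes for \<open>c = 1\<close>, which gives nonnegativity, and for \<open>c = -1\<close>,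
  which gives the upper bound 2. Both row and column sums enter.\<close>

lemma mixing_quadratic_identity:
  fixes x :: "('N::finite, 'n::finite) svec"
  assumes "doubly_stochastic W"
  shows "(norm x)\<^sup>2 - c * (x \<bullet> (kronecker W (mat 1) *v x)) + (c\<^sup>2 - 1) / 2 * (norm x)\<^sup>2
    = 1 / 2 * (\<Sum>i\<in>UNIV. \<Sum>j\<in>UNIV. W $ i $ j * (norm (agent_block x i - c *\<^sub>R agent_block x j))\<^sup>2)"
proof -
  let ?b = "agent_block x"
  have rows: "(\<Sum>j\<in>UNIV. W $ i $ j) = 1" "(\<Sum>i\<in>UNIV. W $ i $ j) = 1" for i j
    using assms by (auto simp: doubly_stochastic_def)
  have 1: "(\<Sum>i\<in>UNIV. \<Sum>j\<in>UNIV. W $ i $ j * (norm (?b i))\<^sup>2) = (norm x)\<^sup>2"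
    by (simp add: rows norm_agent_block flip: sum_distrib_right)
  have 2: "(\<Sum>i\<in>UNIV. \<Sum>j\<in>UNIV. W $ i $ j * (norm (?b j))\<^sup>2) = (norm x)\<^sup>2"
    by (subst sum.swap) (simp add: rows norm_agent_block flip: sum_distrib_right)
  have 3: "x \<bullet> (kronecker W (mat 1) *v x) = (\<Sum>i\<in>UNIV. \<Sum>j\<in>UNIV. W $ i $ j * (?b i \<bullet> ?b j))"
    by (simp add: inner_agent_block agent_block_kronecker inner_sum_right)
  have "W $ i $ j * (norm (?b i - c *\<^sub>R ?b j))\<^sup>2 = W $ i $ j * (norm (?b i))\<^sup>2
      - 2 * c * (W $ i $ j * (?b i \<bullet> ?b j)) + c\<^sup>2 * (W $ i $ j * (norm (?b j))\<^sup>2)" for i j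
    unfolding power2_norm_eq_inner
    by (simp add: inner_diff_left inner_diff_right inner_commute power2_eq_square algebra_simps)
  then have "(\<Sum>i\<in>UNIV. \<Sum>j\<in>UNIV. W $ i $ j * (norm (?b i - c *\<^sub>R ?b j))\<^sup>2)
      = (norm x)\<^sup>2 - 2 * c * (x \<bullet> (kronecker W (mat 1) *v x)) + c\<^sup>2 * (norm x)\<^sup>2"
    by (simp add: sum.distrib sum_subtractf 1 2 3 flip: sum_distrib_left)
  then show ?thesis by (simp add: field_simps)
qed

lemma transpose_kronecker: "transpose (kronecker A B) = kronecker (transpose A) (transpose B)"
  by (simp add: transpose_def kronecker_def vec_eq_iff)

lemma pos_semidef_mixing_laplacian:
  assumes "mixing_matrix E W"
  shows "pos_semidef (mat 1 - kronecker W (mat 1) :: ('a::finite, 'b::finite) smat)"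
proof -
  have W: "doubly_stochastic W" "transpose W = W" using assms by (auto simp: mixing_matrix_def)
  have "0 \<le> x \<bullet> ((mat 1 - kronecker W (mat 1)) *v x)" for x :: "('a, 'b) svec"
  proof -
    have "0 \<le> 1 / 2 * (\<Sum>i\<in>UNIV. \<Sum>j\<in>UNIV. W $ i $ j * (norm (agent_block x i - 1 *\<^sub>R agent_block x j))\<^sup>2)"
      using W(1) by (auto simp: doubly_stochastic_def intro!: sum_nonneg mult_nonneg_nonneg)
    then show ?thesis
      unfolding mixing_quadratic_identity[OF W(1), symmetric]
      by (simp add: matrix_vector_mult_diff_rdistrib inner_diff_right dot_square_norm)
  qed
  moreover have "transpose (mat 1 - kronecker W (mat 1))
      = (mat 1 - kronecker W (mat 1) :: ('a, 'b) smat)"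
  proof (rule symmetricI)
    have sym: "transpose (kronecker W (mat 1)) = (kronecker W (mat 1) :: ('a, 'b) smat)"
      by (simp add: transpose_kronecker W(2))
    show "x \<bullet> ((mat 1 - kronecker W (mat 1)) *v y) = y \<bullet> ((mat 1 - kronecker W (mat 1)) *v x)"
      for x y :: "('a, 'b) svec"
      using symmetric_inner[OF sym, of x y]
      by (simp add: matrix_vector_mult_diff_rdistrib inner_diff_right inner_commute)
  qed
  ultimately show ?thesis by (simp add: pos_semidef_def)
qed

text \<open>The strict bound rests on the positive diagonal of \<open>W\<close>, which excludes the eigenvalue \<open>-1\<close>.\<close>
lemma mixing_laplacian_less_2:
  assumes "mixing_matrix E W" "x \<noteq> 0"
  shows "x \<bullet> ((mat 1 - kronecker W (mat 1)) *v x) < 2 * (norm x)\<^sup>2"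
proof -
  have W: "doubly_stochastic W" using assms by (auto simp: mixing_matrix_def)
  have pos: "0 < W $ i $ i" for i using assms by (auto simp: mixing_matrix_def)
  have nonneg: "0 \<le> W $ i $ j * (norm (agent_block x i - (-1) *\<^sub>R agent_block x j))\<^sup>2" for i j
    using W by (simp add: doubly_stochastic_def)
  obtain i where i: "agent_block x i \<noteq> 0"
    using assms(2) agent_block_eqI[of x 0] by auto
  have "0 < (\<Sum>i\<in>UNIV. \<Sum>j\<in>UNIV. W $ i $ j * (norm (agent_block x i - (-1) *\<^sub>R agent_block x j))\<^sup>2)"
  proof (rule sum_pos2[of _ i])
    show "0 < (\<Sum>j\<in>UNIV. W $ i $ j * (norm (agent_block x i - (-1) *\<^sub>R agent_block x j))\<^sup>2)"
    proof (rule sum_pos2[of _ i])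
      have "agent_block x i - (-1) *\<^sub>R agent_block x i = 2 *\<^sub>R agent_block x i"
        by (simp add: scaleR_2)
      then show "0 < W $ i $ i * (norm (agent_block x i - (-1) *\<^sub>R agent_block x i))\<^sup>2"
        using i pos[of i] by simp
    qed (use nonneg in auto)
  qed (use nonneg in \<open>auto intro: sum_nonneg\<close>)
  then have "0 < 1 / 2 * (\<Sum>i\<in>UNIV. \<Sum>j\<in>UNIV. W $ i $ j
      * (norm (agent_block x i - (-1) *\<^sub>R agent_block x j))\<^sup>2)"
    by linarith
  then show ?thesis
    unfolding mixing_quadratic_identity[OF W, symmetric]
    by (simp add: matrix_vector_mult_diff_rdistrib inner_diff_right dot_square_norm)
qed

section \<open>Saddle points and the exact step\<close>

text \<open>The network enters through \<open>V_sym\<close> and \<open>V_bound\<close>. The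
  strictness of the latter is what admits equality in the step-size condition
  \<open>\<tau>_\<beta>\<close>.\<close>

locale consensus_problem =
  fixes f :: "'N::finite \<Rightarrow> real ^ 'n::finite \<Rightarrow> real"
    and g :: "'N \<Rightarrow> real ^ 'n \<Rightarrow> ereal"
    and L \<tau> :: "'N \<Rightarrow> real" and \<beta> :: real and V :: "('N, 'n) smat"
  assumes L_pos: "\<And>i. 0 < L i"
    and f_convex: "\<And>i. convex_on UNIV (f i)"
    and f_smooth: "\<And>i. smooth_fun (L i) (f i)"
    and g_pcc: "\<And>i. proper_closed_convex (g i)"
    and V_sym: "transpose V = V"
    and V_bound: "\<And>y. y \<noteq> 0 \<Longrightarrow> (norm (V *v y))\<^sup>2 < 2 * (norm y)\<^sup>2"
    and \<tau>_pos: "\<And>i. 0 < \<tau> i" and \<tau>_less: "\<And>i. \<tau> i < 2 / L i"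
    and \<beta>_pos: "0 < \<beta>" and \<tau>_\<beta>: "\<And>i. 2 * \<tau> i \<le> 1 / \<beta>"
begin

abbreviation "F \<equiv> stacked_sum f"
abbreviation "G \<equiv> stacked_sum g"
abbreviation "\<Gamma> \<equiv> agent_diag \<tau> :: ('N, 'n) smat"
abbreviation "\<Gamma>i \<equiv> agent_diag (\<lambda>i. 1 / \<tau> i) :: ('N, 'n) smat"
abbreviation "LF \<equiv> agent_diag L :: ('N, 'n) smat"

section \<open>Positivity of \<open>H\<close> and \<open>H1\<close>\<close>

definition Q :: "('N, 'n) pdmat" where "Q = block_mat (matrix_inv \<Gamma>) V 0 (mat (1 / \<beta>))"
definition M :: "('N, 'n) pdmat" where "M = block_mat (mat 1) (\<Gamma> ** V) 0 (mat 1)"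
definition H :: "('N, 'n) pdmat" where "H = Q ** matrix_inv M"
definition Gm :: "('N, 'n) pdmat" where "Gm = transpose Q + Q - transpose M ** H ** M"
definition H1 :: "('N, 'n) pdmat" where "H1 = Gm - (1/2) *\<^sub>R block_mat LF 0 0 0"

lemma matrix_inv_\<Gamma>: "matrix_inv \<Gamma> = \<Gamma>i"
  using \<tau>_pos by (intro matrix_inv_agent_diag) (metis less_irrefl)

lemma \<Gamma>_inverse: "\<Gamma>i *v (\<Gamma> *v x) = x" "\<Gamma> *v (\<Gamma>i *v x) = x"
  using \<tau>_pos by (auto intro!: agent_block_eqI simp: less_imp_neq[symmetric])

lemma V_inner: "x \<bullet> (V *v y) = (V *v x) \<bullet> y"
  by (rule symmetric_inner[OF V_sym])

lemma \<Gamma>i_inner: "x \<bullet> (\<Gamma>i *v y) = y \<bullet> (\<Gamma>i *v x)"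
  by (simp add: inner_agent_diag inner_commute)

lemma Q_col: "Q *v col x y = col (\<Gamma>i *v x + V *v y) ((1 / \<beta>) *\<^sub>R y)"
  by (simp add: Q_def matrix_inv_\<Gamma> block_mat_col mat_scale_vector)

lemma M_col: "M *v col x y = col (x + \<Gamma> *v (V *v y)) y"
  by (simp add: M_def block_mat_col matrix_vector_mul_assoc)

text \<open>\<open>M\<close> is unipotent, so its inverse flips the sign of the off-diagonal block,
  and that cancels \<open>V\<close> in \<open>Q\<close>: \<open>H\<close> is block diagonal.\<close>

lemma H_col: "H *v col x y = col (\<Gamma>i *v x) ((1 / \<beta>) *\<^sub>R y)"
proof -
  define Mi :: "('N, 'n) pdmat" where "Mi = block_mat (mat 1) (- (\<Gamma> ** V)) 0 (mat 1)"
  have Mi: "Mi *v col x y = col (x - \<Gamma> *v (V *v y)) y" for x y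
  proof -
    have "- (\<Gamma> ** V) *v y = - (\<Gamma> *v (V *v y))"
      by (simp add: matrix_vector_mul_assoc) (simp add: vec_eq_iff matrix_vector_mult_def sum_negf)
    then show ?thesis by (simp add: Mi_def block_mat_col)
  qed
  have "(M ** Mi) *v u = u" for u
    using Mi[of "upper u" "lower u"] M_col
    by (simp add: matrix_vector_mult_diff_distrib flip: matrix_vector_mul_assoc)
  then have "matrix_inv M = Mi" by (intro matrix_inv_eqI) (simp add: matrix_eq)
  then show ?thesis
    by (simp add: H_def Mi Q_col matrix_vector_mult_diff_distrib \<Gamma>_inverse
        flip: matrix_vector_mul_assoc)
qed

lemma H_form: "col x y \<bullet> (H *v col x y) = x \<bullet> (\<Gamma>i *v x) + (norm y)\<^sup>2 / \<beta>"
  by (simp add: H_col inner_col dot_square_norm)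

lemma H_inner: "u \<bullet> (H *v v) = v \<bullet> (H *v u)"
proof -
  have "col x y \<bullet> (H *v col x' y') = col x' y' \<bullet> (H *v col x y)" for x y x' y'
    by (simp add: H_col inner_col inner_commute[of y] \<Gamma>i_inner[of x x'])
  from this[of "upper u" "lower u" "upper v" "lower v"] show ?thesis by simp
qed

lemma Gm_inner: "u \<bullet> (Gm *v v) = v \<bullet> (Q *v u) + u \<bullet> (Q *v v) - (M *v u) \<bullet> (H *v (M *v v))"
proof -
  have "u \<bullet> ((transpose M ** H ** M) *v v) = (M *v u) \<bullet> (H *v (M *v v))"
    using inner_matrix_vector_transpose[of u "transpose M" "H *v (M *v v)"]
    by (simp flip: matrix_vector_mul_assoc)
  moreover have "u \<bullet> (transpose Q *v v) = v \<bullet> (Q *v u)"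
    using inner_matrix_vector_transpose[of v Q u] by (simp only: inner_commute)
  ultimately show ?thesis
    by (simp only: Gm_def matrix_vector_mult_diff_rdistrib matrix_vector_mult_add_rdistrib
        inner_diff_right inner_add_right)
qed

lemma H1_inner: "u \<bullet> (H1 *v v) = u \<bullet> (Gm *v v) - upper u \<bullet> (LF *v upper v) / 2"
proof -
  have "(block_mat LF 0 0 0 :: ('N, 'n) pdmat) *v v = col (LF *v upper v) 0"
    using block_mat_col[of LF 0 0 0 "upper v" "lower v"] by simp
  moreover have "u \<bullet> col (LF *v upper v) 0 = upper u \<bullet> (LF *v upper v)"
    using inner_col[of "upper u" "lower u" "LF *v upper v" 0] by simp
  ultimately show ?thesis
    by (simp add: H1_def matrix_vector_mult_diff_rdistrib inner_diff_right
        scaleR_matrix_vector_assoc[symmetric])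
qed

text \<open>The cross terms \<open>x \<bullet> (V *v y)\<close> of \<open>Q\<close> and of the
  \<open>H\<close>-norm of \<open>M *v u\<close> cancel, so definiteness splits into a condition on
  \<open>\<tau>\<close> alone and one coupling \<open>\<beta>\<close> with
  \<open>\<tau>\<close>.\<close>

lemma H1_form: "col x y \<bullet> (H1 *v col x y)
  = x \<bullet> (\<Gamma>i *v x) - x \<bullet> (LF *v x) / 2 + (norm y)\<^sup>2 / \<beta> - (V *v y) \<bullet> (\<Gamma> *v (V *v y))"
proof -
  have "(x + \<Gamma> *v (V *v y)) \<bullet> (\<Gamma>i *v (x + \<Gamma> *v (V *v y)))
      = x \<bullet> (\<Gamma>i *v x) + 2 * (x \<bullet> (V *v y)) + (V *v y) \<bullet> (\<Gamma> *v (V *v y))"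
    using \<Gamma>i_inner[of "\<Gamma> *v (V *v y)" x]
    by (simp add: matrix_vector_right_distrib inner_add_left inner_add_right \<Gamma>_inverse
        inner_commute[of _ "V *v y"])
  then show ?thesis
    by (simp add: H1_inner Gm_inner Q_col M_col H_form inner_col inner_add_right dot_square_norm)
qed

lemma pos_semidef_H: "pos_semidef H"
proof -
  have "0 \<le> u \<bullet> (H *v u)" for u
  proof -
    have "0 \<le> upper u \<bullet> (\<Gamma>i *v upper u)"
      unfolding inner_agent_diag
      by (intro sum_nonneg mult_nonneg_nonneg) (simp_all add: less_imp_le[OF \<tau>_pos])
    then show ?thesis using H_form[of "upper u" "lower u"] \<beta>_pos by simp
  qed
  moreover have "transpose H = H" by (rule symmetricI) (rule H_inner)
  ultimately show ?thesis by (simp add: pos_semidef_def)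
qed

lemma transpose_H1: "transpose H1 = H1"
proof (rule symmetricI)
  fix u v
  have "(M *v u) \<bullet> (H *v (M *v v)) = (M *v v) \<bullet> (H *v (M *v u))" by (rule H_inner)
  then show "u \<bullet> (H1 *v v) = v \<bullet> (H1 *v u)"
    by (simp add: H1_inner Gm_inner inner_agent_diag inner_commute)
qed

text \<open>\<open>\<tau> i \<le> 1 / (2 * \<beta>)\<close> and the factor 2 in
  \<open>V_bound\<close> balance exactly; positivity comes from the strictness of
  \<open>V_bound\<close>.\<close>

lemma dual_block_pos:
  assumes "y \<noteq> 0"
  shows "0 < (norm y)\<^sup>2 / \<beta> - (V *v y) \<bullet> (\<Gamma> *v (V *v y))"
proof -
  have "(V *v y) \<bullet> (\<Gamma> *v (V *v y)) \<le> (\<Sum>i\<in>UNIV. 1 / (2 * \<beta>) * (norm (agent_block (V *v y) i))\<^sup>2)"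
    unfolding inner_agent_diag dot_square_norm
  proof (intro sum_mono mult_right_mono)
    show "\<tau> i \<le> 1 / (2 * \<beta>)" for i using \<tau>_\<beta>[of i] by simp
  qed simp
  also have "\<dots> = 1 / (2 * \<beta>) * (norm (V *v y))\<^sup>2"
    by (simp add: norm_agent_block sum_distrib_left)
  also have "\<dots> < 1 / (2 * \<beta>) * (2 * (norm y)\<^sup>2)"
    using V_bound[OF assms] \<beta>_pos by (intro mult_strict_left_mono) auto
  finally show ?thesis by simp
qed

lemma primal_block_pos:
  assumes "x \<noteq> 0"
  shows "0 < x \<bullet> (\<Gamma>i *v x) - x \<bullet> (LF *v x) / 2"
proof -
  obtain i where i: "agent_block x i \<noteq> 0" using assms agent_block_eqI[of x 0] by auto
  have c: "0 < 1 / \<tau> j - L j / 2" for j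
    using \<tau>_less[of j] \<tau>_pos[of j] L_pos[of j] by (simp add: field_simps)
  have "0 < (\<Sum>i\<in>UNIV. (1 / \<tau> i - L i / 2) * (norm (agent_block x i))\<^sup>2)"
  proof (rule sum_pos2[of _ i])
    show "0 < (1 / \<tau> i - L i / 2) * (norm (agent_block x i))\<^sup>2"
      using i by (intro mult_pos_pos c) simp
    show "0 \<le> (1 / \<tau> j - L j / 2) * (norm (agent_block x j))\<^sup>2" for j
      by (intro mult_nonneg_nonneg less_imp_le[OF c]) simp
  qed simp_all
  also have "\<dots> = x \<bullet> (\<Gamma>i *v x) - x \<bullet> (LF *v x) / 2"
    by (simp add: inner_agent_diag dot_square_norm sum_divide_distrib algebra_simps
        flip: sum_subtractf)
  finally show ?thesis .
qed

lemma H1_pos: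
  assumes "u \<noteq> 0"
  shows "0 < u \<bullet> (H1 *v u)"
proof -
  have *: "u \<bullet> (H1 *v u) = (upper u \<bullet> (\<Gamma>i *v upper u) - upper u \<bullet> (LF *v upper u) / 2)
      + ((norm (lower u))\<^sup>2 / \<beta> - (V *v lower u) \<bullet> (\<Gamma> *v (V *v lower u)))"
    using H1_form[of "upper u" "lower u"] by simp
  have "upper u \<noteq> 0 \<or> lower u \<noteq> 0" using assms by (metis col_0 col_upper_lower)
  then show ?thesis
    unfolding * using primal_block_pos[of "upper u"] dual_block_pos[of "lower u"]
    by (cases "upper u = 0"; cases "lower u = 0") auto
qed

lemma H1_le_H: "u \<bullet> (H1 *v u) \<le> u \<bullet> (H *v u)"
proof -
  have "0 \<le> (V *v lower u) \<bullet> (\<Gamma> *v (V *v lower u))" "0 \<le> upper u \<bullet> (LF *v upper u)"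
    unfolding inner_agent_diag
    by (intro sum_nonneg mult_nonneg_nonneg inner_ge_zero less_imp_le \<tau>_pos L_pos)+
  then show ?thesis
    using H1_form[of "upper u" "lower u"] H_form[of "upper u" "lower u"] by simp
qed

section \<open>Saddle points as zeros of the KKT map\<close>

lemma zero_in_kkt_map_iff:
  "0 \<in> kkt_map F G V u \<longleftrightarrow>
     V *v lower u - gradient F (upper u) \<in> subdifferential G (upper u) \<and> V *v upper u = 0"
proof -
  have "0 = col a b \<longleftrightarrow> a = 0 \<and> b = 0" for a b :: "('N, 'n) svec"
    using col_eq_iff[of a b 0 0] by auto
  moreover have "s + gradient F (upper u) - V *v lower u = 0
      \<longleftrightarrow> s = V *v lower u - gradient F (upper u)" for s
    by (auto simp: algebra_simps)
  ultimately show ?thesis unfolding kkt_map_def by auto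
qed

text \<open>Subregularity speaks of zeros of the KKT map, the conclusion of saddle points. Fermat's
  rule gives one inclusion, the gradient and subgradient inequalities the other.\<close>

lemma saddle_points_eq_kkt_zeros: "saddle_points F G V = {u. 0 \<in> kkt_map F G V u}"
proof (intro equalityI subsetI)
  fix u assume u: "u \<in> saddle_points F G V"
  define x \<alpha> where "x = upper u" and "\<alpha> = lower u"
  have dual: "lagrangian F G V x \<alpha>' \<le> lagrangian F G V x \<alpha>"
    and primal: "lagrangian F G V x \<alpha> \<le> lagrangian F G V x' \<alpha>" for x' \<alpha>'
    using u by (auto simp: saddle_points_def x_def \<alpha>_def)
  obtain x0 where "G x0 \<noteq> \<infinity>" using stacked_sum_proper[where g = g, OF g_pcc] by blast
  \<comment> \<open>A point of the domain of \<open>G\<close> bounds the Lagrangian at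
    \<open>x\<close>, so the saddle inequalities do not merely compare infinities.\<close>
  then have "G x \<noteq> \<infinity>"
    using primal[of x0] by (cases "G x0"; cases "G x") (auto simp: lagrangian_def)
  then obtain r where r: "G x = ereal r"
    using stacked_sum_not_MInf[where g = g, OF g_pcc, of x] by (cases "G x") auto
  \<comment> \<open>Moving the multiplier by \<open>- V *v x\<close> raises the Lagrangian by the
    squared norm of \<open>V *v x\<close>.\<close>
  have "V *v x = 0"
    using dual[of "\<alpha> - V *v x"] by (simp add: lagrangian_def r inner_diff_left dot_square_norm)
  moreover have "- (gradient F x - V *v \<alpha>) \<in> subdifferential G x"
  proof (rule subdifferential_minimum[where \<phi> = "\<lambda>y. F y - \<alpha> \<bullet> (V *v y)"])
    have "GDERIV (\<lambda>y. \<alpha> \<bullet> (V *v y)) x :> V *v \<alpha>"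
      unfolding gderiv_def
    proof (rule has_derivative_eq_rhs)
      show "((\<lambda>y. \<alpha> \<bullet> (V *v y)) has_derivative (\<lambda>h. \<alpha> \<bullet> (V *v h))) (at x)"
        by (intro has_derivative_inner_right bounded_linear_imp_has_derivative
            matrix_vector_mul_bounded_linear)
      show "(\<lambda>h. \<alpha> \<bullet> (V *v h)) = (\<lambda>h. h \<bullet> (V *v \<alpha>))"
        by (metis V_inner inner_commute)
    qed
    then show "GDERIV (\<lambda>y. F y - \<alpha> \<bullet> (V *v y)) x :> gradient F x - V *v \<alpha>"
      by (intro GDERIV_diff GDERIV_stacked_smooth[where f = f and L = L, OF f_smooth])
    show "ereal (F x - \<alpha> \<bullet> (V *v x)) + G x \<le> ereal (F y - \<alpha> \<bullet> (V *v y)) + G y" for y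
      using primal[of y] by (cases "G y") (auto simp: lagrangian_def r algebra_simps)
  qed (fact stacked_sum_convex[where g = g, OF g_pcc] stacked_sum_not_MInf[where g = g, OF g_pcc] stacked_sum_proper[where g = g, OF g_pcc])+
  ultimately show "u \<in> {u. 0 \<in> kkt_map F G V u}"
    by (simp add: zero_in_kkt_map_iff x_def \<alpha>_def)
next
  fix u assume "u \<in> {u. 0 \<in> kkt_map F G V u}"
  then have sub: "V *v lower u - gradient F (upper u) \<in> subdifferential G (upper u)"
    and V0: "V *v upper u = 0" by (auto simp: zero_in_kkt_map_iff)
  have "lagrangian F G V (upper u) \<alpha> \<le> lagrangian F G V (upper u) (lower u)" for \<alpha>
    by (simp add: lagrangian_def V0)
  moreover have "lagrangian F G V (upper u) (lower u) \<le> lagrangian F G V x (lower u)" for x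
  proof -
    have "F (upper u) + gradient F (upper u) \<bullet> (x - upper u) \<le> F x"
      by (rule stacked_gradient_inequality[where f = f and L = L, OF f_smooth f_convex])
    moreover have "G (upper u) + ereal ((V *v lower u - gradient F (upper u)) \<bullet> (x - upper u)) \<le> G x"
      using sub by (simp add: subdifferential_def)
    moreover have "(V *v lower u - gradient F (upper u)) \<bullet> (x - upper u)
        = lower u \<bullet> (V *v x) - gradient F (upper u) \<bullet> (x - upper u)"
      using V_inner[of "lower u" x] V_inner[of "lower u" "upper u"] V0
      by (simp add: inner_diff_left inner_diff_right)
    ultimately show ?thesis
      using stacked_sum_not_MInf[where g = g, OF g_pcc, of x] stacked_sum_not_MInf[where g = g, OF g_pcc, of "upper u"]
      by (cases "G x"; cases "G (upper u)") (auto simp: lagrangian_def V0)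
  qed
  ultimately show "u \<in> saddle_points F G V" by (simp add: saddle_points_def)
qed

section \<open>Prediction and correction as functions of the residual\<close>

definition predictor where
  "predictor x \<alpha> d = prox (matrix_inv \<Gamma>) G (x - \<Gamma> *v (gradient F x - V *v \<alpha> - d))"

definition predicted where
  "predicted u d = col (predictor (upper u) (lower u) d)
     (lower u - \<beta> *\<^sub>R (V *v predictor (upper u) (lower u) d))"

text \<open>With \<open>d\<close> as an argument, \<open>corrected u 0\<close> is the exact step
  from the same point, to which the inexact iterate is compared.\<close>

definition corrected where
  "corrected u d = u - M *v (u - predicted u d)"

lemma predictor_subgradient:
  "\<Gamma>i *v (x - predictor x \<alpha> d) - gradient F x + V *v \<alpha> + d \<in> subdifferential G (predictor x \<alpha> d)"
proof -
  let ?z = "x - \<Gamma> *v (gradient F x - V *v \<alpha> - d)"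
  have "\<Gamma>i *v (?z - predictor x \<alpha> d) \<in> subdifferential G (predictor x \<alpha> d)"
    by (rule stacked_prox_optimality[where g = g, OF g_pcc])
      (use \<tau>_pos in \<open>auto simp: predictor_def matrix_inv_\<Gamma>\<close>)
  moreover have "\<Gamma>i *v (?z - predictor x \<alpha> d)
      = \<Gamma>i *v (x - predictor x \<alpha> d) - gradient F x + V *v \<alpha> + d"
    by (simp add: matrix_vector_mult_diff_distrib \<Gamma>_inverse)
  ultimately show ?thesis by simp
qed

text \<open>Weighting the monotonicity inequality by \<open>\<Gamma>\<close> cancels the
  \<open>\<Gamma>i\<close> in front of the difference of the two predictors, leaving its plain
  squared norm.\<close>

lemma predictor_perturbation:
  "norm (predictor x \<alpha> d - predictor x \<alpha> d') \<le> sigma_max \<Gamma> * norm (d - d')"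
proof -
  define p q where "p = predictor x \<alpha> d" and "q = predictor x \<alpha> d'"
  have "0 \<le> (p - q) \<bullet> (\<Gamma> *v ((\<Gamma>i *v (x - p) - gradient F x + V *v \<alpha> + d)
      - (\<Gamma>i *v (x - q) - gradient F x + V *v \<alpha> + d')))"
    unfolding p_def q_def
    by (intro stacked_subdifferential_weighted_monotone[where g = g, OF g_pcc] predictor_subgradient
        less_imp_le[OF \<tau>_pos])
  also have "\<Gamma> *v ((\<Gamma>i *v (x - p) - gradient F x + V *v \<alpha> + d)
      - (\<Gamma>i *v (x - q) - gradient F x + V *v \<alpha> + d')) = \<Gamma> *v (d - d') - (p - q)"
    by (simp add: matrix_vector_mult_diff_distrib matrix_vector_right_distrib \<Gamma>_inverse)
  finally have "(norm (p - q))\<^sup>2 \<le> (p - q) \<bullet> (\<Gamma> *v (d - d'))"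
    by (simp add: inner_diff_right[of "p - q" "\<Gamma> *v (d - d')"] dot_square_norm)
  also have "\<dots> \<le> norm (p - q) * norm (\<Gamma> *v (d - d'))" by (rule norm_cauchy_schwarz)
  finally have "norm (p - q) \<le> norm (\<Gamma> *v (d - d'))"
    by (cases "norm (p - q) = 0") (simp_all add: power2_eq_square)
  also have "\<dots> \<le> sigma_max \<Gamma> * norm (d - d')" by (rule norm_le_sigma_max)
  finally show ?thesis by (simp add: p_def q_def)
qed

text \<open>This is where \<open>\<mu>bar\<close> comes from: \<open>sigma_max \<Gamma>\<close> for
  the primal prediction, \<open>\<beta> * sigma_max V + 1\<close> for adding the dual one, and the
  remaining factor for the correction by \<open>M\<close> measured in the
  \<open>H\<close>-norm.\<close>

lemma corrected_perturbation:
  "wnorm H (corrected u d - corrected u d')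
    \<le> sigma_max (psd_sqrt H ** M) * sigma_max \<Gamma> * (\<beta> * sigma_max V + 1) * norm (d - d')"
proof -
  define q where "q = predictor (upper u) (lower u) d - predictor (upper u) (lower u) d'"
  have "predicted u d - predicted u d' = col q (- \<beta> *\<^sub>R (V *v q))"
    by (simp add: predicted_def q_def col_linear matrix_vector_mult_diff_distrib
        scaleR_right_diff_distrib)
  then have "norm (predicted u d - predicted u d') \<le> norm q + norm (\<beta> *\<^sub>R (V *v q))"
    using norm_col_le[of q "- \<beta> *\<^sub>R (V *v q)"] by simp
  also have "\<dots> \<le> norm q + \<beta> * (sigma_max V * norm q)"
    using norm_le_sigma_max[of V q] \<beta>_pos by simp
  also have "\<dots> = (\<beta> * sigma_max V + 1) * norm q" by (simp add: algebra_simps)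
  also have "\<dots> \<le> (\<beta> * sigma_max V + 1) * (sigma_max \<Gamma> * norm (d - d'))"
    using \<beta>_pos sigma_max_nonneg[of V] unfolding q_def
    by (intro mult_left_mono predictor_perturbation) auto
  finally have *: "norm (predicted u d - predicted u d')
    \<le> (\<beta> * sigma_max V + 1) * (sigma_max \<Gamma> * norm (d - d'))" .
  have "corrected u d - corrected u d' = M *v (predicted u d - predicted u d')"
    by (simp add: corrected_def matrix_vector_mult_diff_distrib)
  then have "wnorm H (corrected u d - corrected u d')
      = norm ((psd_sqrt H ** M) *v (predicted u d - predicted u d'))"
    by (simp add: wnorm_psd_sqrt[OF pos_semidef_H] matrix_vector_mul_assoc)
  also have "\<dots> \<le> sigma_max (psd_sqrt H ** M) * norm (predicted u d - predicted u d')"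
    by (rule norm_le_sigma_max)
  also have "\<dots> \<le> sigma_max (psd_sqrt H ** M)
      * ((\<beta> * sigma_max V + 1) * (sigma_max \<Gamma> * norm (d - d')))"
    by (intro mult_left_mono * sigma_max_nonneg)
  finally show ?thesis by (simp add: mult_ac)
qed

text \<open>Three facts enter: monotonicity of the subdifferential between the prediction and
  \<open>w\<close>, the three-point inequality for the gradient, and feasibility
  \<open>V *v xs = 0\<close>. The rest is expansion of quadratic forms.\<close>

lemma corrected_fejer:
  assumes w: "0 \<in> kkt_map F G V w"
  shows "(wnorm H (corrected u 0 - w))\<^sup>2
    \<le> (wnorm H (u - w))\<^sup>2 - (u - predicted u 0) \<bullet> (H1 *v (u - predicted u 0))"
proof -
  define x \<alpha> where "x = upper u" and "\<alpha> = lower u"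
  define xs \<alpha>s where "xs = upper w" and "\<alpha>s = lower w"
  define p where "p = predictor x \<alpha> 0"
  define a where "a = \<beta> *\<^sub>R (V *v p)"
  \<comment> \<open>The pair \<open>(e, a)\<close> is the gap between \<open>u\<close> and its
    prediction, \<open>(y, b)\<close> the displacement of the prediction from
    \<open>w\<close>.\<close>
  define e where "e = x - p"
  define y where "y = p - xs"
  define b where "b = \<alpha> - a - \<alpha>s"
  have pred: "predicted u 0 = col p (\<alpha> - a)"
    by (simp add: predicted_def x_def \<alpha>_def p_def a_def)
  have u: "u = col x \<alpha>" and w': "w = col xs \<alpha>s" by (simp_all add: x_def \<alpha>_def xs_def \<alpha>s_def)
  have uw: "u - w = col (y + e) (b + a)"
    by (simp add: u w' col_linear y_def e_def b_def)
  have uh: "u - predicted u 0 = col e a"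
    unfolding pred by (simp add: u col_linear e_def)
  have cw: "corrected u 0 - w = col (y - \<Gamma> *v (V *v a)) b"
    unfolding corrected_def uh M_col by (simp add: u w' col_linear y_def e_def b_def)
  have xs: "V *v \<alpha>s - gradient F xs \<in> subdifferential G xs" "V *v xs = 0"
    using w by (simp_all add: zero_in_kkt_map_iff xs_def \<alpha>s_def)
  have "0 \<le> (p - xs) \<bullet> (agent_diag (\<lambda>_. 1) *v
      ((\<Gamma>i *v (x - p) - gradient F x + V *v \<alpha> + 0) - (V *v \<alpha>s - gradient F xs)))"
    unfolding p_def
    by (intro stacked_subdifferential_weighted_monotone[where g = g, OF g_pcc] predictor_subgradient xs(1)) simp
  also have "\<dots> = y \<bullet> ((\<Gamma>i *v e - gradient F x + V *v \<alpha>) - (V *v \<alpha>s - gradient F xs))"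
  proof -
    have "agent_diag (\<lambda>_. 1) *v z = z" for z :: "('N, 'n) svec"
      by (rule agent_block_eqI) simp
    then show ?thesis by (simp add: y_def e_def)
  qed
  also have "\<dots> = y \<bullet> (\<Gamma>i *v e) + y \<bullet> (V *v a) + y \<bullet> (V *v b) - y \<bullet> (gradient F x - gradient F xs)"
    by (simp add: b_def matrix_vector_mult_diff_distrib inner_diff_right inner_add_right)
  finally have mono: "y \<bullet> (gradient F x - gradient F xs)
      \<le> y \<bullet> (\<Gamma>i *v e) + y \<bullet> (V *v a) + y \<bullet> (V *v b)" by simp
  have "- (1 / 4) * (e \<bullet> (LF *v e)) \<le> y \<bullet> (gradient F x - gradient F xs)"
    unfolding e_def y_def by (rule stacked_three_point[where f = f and L = L, OF f_smooth f_convex L_pos])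
  with mono have key: "- (1 / 4) * (e \<bullet> (LF *v e))
      \<le> y \<bullet> (\<Gamma>i *v e) + y \<bullet> (V *v a) + y \<bullet> (V *v b)" by linarith
  \<comment> \<open>Feasibility removes \<open>xs\<close>, and \<open>V *v p\<close> is the dual
    update \<open>a\<close> up to the factor \<open>\<beta>\<close>.\<close>
  have "y \<bullet> (V *v b) = (V *v p) \<bullet> b"
    using xs(2) by (simp add: V_inner y_def matrix_vector_mult_diff_distrib)
  also have "\<dots> = (b \<bullet> a) / \<beta>" using \<beta>_pos by (simp add: a_def inner_commute)
  finally have Vb: "y \<bullet> (V *v b) = (b \<bullet> a) / \<beta>" .
  have 1: "(wnorm H (u - w))\<^sup>2 = y \<bullet> (\<Gamma>i *v y) + 2 * (y \<bullet> (\<Gamma>i *v e)) + e \<bullet> (\<Gamma>i *v e)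
      + ((norm b)\<^sup>2 + 2 * (b \<bullet> a) + (norm a)\<^sup>2) / \<beta>"
    unfolding wnorm_square[OF pos_semidef_H] uw H_form
    using \<Gamma>i_inner[of e y]
    by (simp add: matrix_vector_right_distrib inner_add_left inner_add_right power2_norm_eq_inner
        inner_commute[of a b])
  have 2: "(wnorm H (corrected u 0 - w))\<^sup>2 = y \<bullet> (\<Gamma>i *v y) - 2 * (y \<bullet> (V *v a))
      + (V *v a) \<bullet> (\<Gamma> *v (V *v a)) + (norm b)\<^sup>2 / \<beta>"
    unfolding wnorm_square[OF pos_semidef_H] cw H_form
    using \<Gamma>i_inner[of "\<Gamma> *v (V *v a)" y]
    by (simp add: matrix_vector_mult_diff_distrib inner_diff_left inner_diff_right \<Gamma>_inverse
        inner_commute[of _ "V *v a"])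
  \<comment> \<open>After expansion the claim is twice \<open>key\<close>.\<close>
  show ?thesis
    unfolding 1 2 uh H1_form using key Vb by (simp add: add_divide_distrib)
qed

text \<open>Both components are built from the gap: the primal one from differences between
  \<open>x\<close> and \<open>p\<close> and from \<open>a\<close>, the dual one because
  \<open>V *v p\<close> is \<open>a\<close> divided by \<open>\<beta>\<close>.\<close>

lemma kkt_residual:
  obtains C where "0 \<le> C"
    "\<And>u. \<exists>v\<in>kkt_map F G V (predicted u 0). norm v \<le> C * norm (u - predicted u 0)"
proof
  define K where "K = (MAX i. L i)"
  have K: "L i \<le> K" for i by (simp add: K_def)
  then have K0: "0 \<le> K" using L_pos order_trans less_imp_le by blast
  show "0 \<le> sigma_max \<Gamma>i + K + sigma_max V + 1 / \<beta>"
    using K0 \<beta>_pos sigma_max_nonneg[of \<Gamma>i] sigma_max_nonneg[of V] by simp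
  fix u :: "('N, 'n) pdvec"
  define x \<alpha> where "x = upper u" and "\<alpha> = lower u"
  define p where "p = predictor x \<alpha> 0"
  define a where "a = \<beta> *\<^sub>R (V *v p)"
  define n where "n = norm (u - predicted u 0)"
  have pred: "predicted u 0 = col p (\<alpha> - a)"
    by (simp add: predicted_def x_def \<alpha>_def p_def a_def)
  have u: "u = col x \<alpha>" by (simp add: x_def \<alpha>_def)
  have "u - predicted u 0 = col (x - p) a"
    unfolding pred by (simp add: u col_linear)
  then have n: "norm (x - p) \<le> n" "norm a \<le> n"
    by (simp_all add: n_def norm_le_norm_col)
  \<comment> \<open>The step uses the gradient at \<open>x\<close> and the multiplier
    \<open>\<alpha>\<close>, the KKT map the gradient at \<open>p\<close> and the multiplier
    \<open>\<alpha> - a\<close>; these mismatches form the residual.\<close>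
  let ?r = "\<Gamma>i *v (x - p) + (gradient F p - gradient F x) + V *v a"
  have "\<Gamma>i *v (x - p) - gradient F x + V *v \<alpha> + 0 \<in> subdifferential G p"
    unfolding p_def by (rule predictor_subgradient)
  then have "col (\<Gamma>i *v (x - p) - gradient F x + V *v \<alpha> + 0 + gradient F p - V *v (\<alpha> - a)) (V *v p)
      \<in> kkt_map F G V (predicted u 0)"
    unfolding kkt_map_def pred upper_col lower_col by blast
  moreover have "\<Gamma>i *v (x - p) - gradient F x + V *v \<alpha> + 0 + gradient F p - V *v (\<alpha> - a) = ?r"
    by (simp add: matrix_vector_mult_diff_distrib)
  ultimately have mem: "col ?r (V *v p) \<in> kkt_map F G V (predicted u 0)" by (simp only:)
  have "norm (\<Gamma>i *v (x - p)) \<le> sigma_max \<Gamma>i * n"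
    using norm_le_sigma_max[of \<Gamma>i "x - p"] n(1) sigma_max_nonneg[of \<Gamma>i]
    by (meson mult_left_mono order_trans)
  moreover have "norm (gradient F p - gradient F x) \<le> K * n"
  proof -
    have "norm (gradient F p - gradient F x) \<le> K * norm (p - x)"
      by (rule stacked_smooth_Lipschitz[where f = f and L = L, OF f_smooth less_imp_le[OF L_pos] K])
    also have "\<dots> \<le> K * n" using n(1) K0 by (intro mult_left_mono) (simp_all add: norm_minus_commute)
    finally show ?thesis .
  qed
  moreover have "norm (V *v a) \<le> sigma_max V * n"
    using norm_le_sigma_max[of V a] n(2) sigma_max_nonneg[of V] by (meson mult_left_mono order_trans)
  ultimately have r: "norm ?r \<le> sigma_max \<Gamma>i * n + K * n + sigma_max V * n"
    using norm_triangle_ineq[of "\<Gamma>i *v (x - p) + (gradient F p - gradient F x)" "V *v a"]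
      norm_triangle_ineq[of "\<Gamma>i *v (x - p)" "gradient F p - gradient F x"] by linarith
  have "norm (V *v p) = norm a / \<beta>" using \<beta>_pos by (simp add: a_def)
  also have "\<dots> \<le> n / \<beta>" using n(2) \<beta>_pos by (simp add: divide_right_mono)
  finally have "norm (V *v p) \<le> n / \<beta>" .
  with r have "norm (col ?r (V *v p)) \<le> (sigma_max \<Gamma>i + K + sigma_max V + 1 / \<beta>) * n"
    using norm_col_le[of ?r "V *v p"] by (simp add: distrib_right)
  with mem show "\<exists>v\<in>kkt_map F G V (predicted u 0).
      norm v \<le> (sigma_max \<Gamma>i + K + sigma_max V + 1 / \<beta>) * norm (u - predicted u 0)"
    unfolding n_def by blast
qed

end

section \<open>Error bound and contraction\<close>

lemma infdist_greatest: "A \<noteq> {} \<Longrightarrow> (\<And>a. a \<in> A \<Longrightarrow> r \<le> dist x a) \<Longrightarrow> r \<le> infdist x A"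
  by (simp add: infdist_notempty cINF_greatest)

text \<open>Here \<open>a\<close> is the current point, \<open>b\<close> its exact and
  \<open>c\<close> its inexact successor, all seen through \<open>psd_sqrt H\<close>;
  \<open>\<eta>\<close> is the Fejer decrease and \<open>m\<close> the relative error.\<close>

lemma infdist_perturbed_contraction:
  assumes D: "D \<noteq> {}"
    and fejer: "\<And>p. p \<in> D \<Longrightarrow> (dist b p)\<^sup>2 \<le> (dist a p)\<^sup>2 - \<eta>" and \<eta>: "0 \<le> \<eta>"
    and bound: "r * (infdist a D)\<^sup>2 \<le> \<eta>"
    and \<theta>: "0 \<le> \<theta>" "\<theta>\<^sup>2 = 1 - r"
    and pert: "dist c b \<le> m * dist a c" "0 \<le> m" "m < 1" and \<omega>: "1 \<le> \<omega>"
  shows "infdist c D \<le> (m * (1 + \<omega>) + \<theta>) / (1 - m) * infdist a D"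
proof -
  define A where "A = infdist a D"
  have A0: "0 \<le> A" by (simp add: A_def infdist_nonneg)
  \<comment> \<open>A nearest point of \<open>D\<close> may not exist, so the Fejer inequality is
    put in a form linear in \<open>dist a p\<close> and passed to the infimum.\<close>
  have "sqrt ((infdist b D)\<^sup>2 + \<eta>) \<le> A"
    unfolding A_def
  proof (rule infdist_greatest[OF D])
    fix p assume p: "p \<in> D"
    have "(infdist b D)\<^sup>2 \<le> (dist b p)\<^sup>2"
      by (intro power_mono infdist_le p infdist_nonneg)
    with fejer[OF p] have "(infdist b D)\<^sup>2 + \<eta> \<le> (dist a p)\<^sup>2" by simp
    then show "sqrt ((infdist b D)\<^sup>2 + \<eta>) \<le> dist a p" by (simp add: real_le_lsqrt)
  qed
  then have "(infdist b D)\<^sup>2 + \<eta> \<le> A\<^sup>2" using sqrt_le_D by blast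
  moreover have "(\<theta> * A)\<^sup>2 = A\<^sup>2 - r * A\<^sup>2"
    by (simp only: power_mult_distrib \<theta>(2) left_diff_distrib mult_1)
  moreover have "r * A\<^sup>2 \<le> \<eta>" unfolding A_def by (rule bound)
  ultimately have "(infdist b D)\<^sup>2 \<le> (\<theta> * A)\<^sup>2" by linarith
  then have B: "infdist b D \<le> \<theta> * A"
    by (rule power2_le_imp_le) (use \<theta>(1) A0 in simp)
  \<comment> \<open>The exact step does not move away from any point of \<open>D\<close>, so its
    length is at most twice the distance to \<open>D\<close>.\<close>
  have "dist a b / 2 \<le> A"
    unfolding A_def
  proof (rule infdist_greatest[OF D])
    fix p assume p: "p \<in> D"
    have "(dist b p)\<^sup>2 \<le> (dist a p)\<^sup>2" using fejer[OF p] \<eta> by linarith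
    then have "dist b p \<le> dist a p" by (rule power2_le_imp_le) simp
    then show "dist a b / 2 \<le> dist a p"
      using dist_triangle2[of a b p] by simp
  qed
  then have ac: "(1 - m) * dist a c \<le> 2 * A"
    using dist_triangle[of a c b] pert(1) by (simp add: dist_commute algebra_simps)
  have "infdist c D \<le> \<theta> * A + m * dist a c"
    using infdist_triangle[of c D b] B pert(1) by linarith
  then have "(1 - m) * infdist c D \<le> (1 - m) * (\<theta> * A + m * dist a c)"
    using pert(3) by (intro mult_left_mono) auto
  also have "\<dots> = (1 - m) * \<theta> * A + m * ((1 - m) * dist a c)" by (simp add: algebra_simps)
  also have "\<dots> \<le> 1 * \<theta> * A + m * ((1 + \<omega>) * A)"
  proof (intro add_mono mult_right_mono mult_left_mono)
    \<comment> \<open>The factor 2 from the length of the exact step is weakened to the stated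
      \<open>1 + \<omega>\<close>.\<close>
    have "2 * A \<le> (1 + \<omega>) * A" using \<omega> A0 by (intro mult_right_mono) auto
    with ac show "(1 - m) * dist a c \<le> (1 + \<omega>) * A" by linarith
  qed (use pert \<theta> A0 in auto)
  finally have "(1 - m) * infdist c D \<le> (m * (1 + \<omega>) + \<theta>) * A" by (simp add: algebra_simps)
  then show ?thesis using pert(3) by (simp add: A_def field_simps)
qed

section \<open>Error bound and contraction in the \<open>H\<close>-norm\<close>

context consensus_problem
begin

abbreviation "c1 \<equiv> sqrt (sigma_max H)"
abbreviation "c2 \<equiv> sqrt (sigma_min H1)"
abbreviation "Mstar \<equiv> saddle_points F G V"
abbreviation "\<mu>bar \<equiv> sigma_max (psd_sqrt H ** M) * sigma_max \<Gamma> * (\<beta> * sigma_max V + 1)"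

lemma c2_pos: "0 < c2"
  using sigma_min_pos[OF transpose_H1 H1_pos] by simp

lemma wnorm_nonneg: "0 \<le> wnorm H z"
  by (simp add: wnorm_psd_sqrt[OF pos_semidef_H])

lemma dist_psd_sqrt_H: "dist (psd_sqrt H *v u) (psd_sqrt H *v v) = wnorm H (u - v)"
  by (simp add: wnorm_psd_sqrt[OF pos_semidef_H] dist_norm matrix_vector_mult_diff_distrib)

lemma wnorm_le_c1: "wnorm H z \<le> c1 * norm z"
  by (rule power2_le_imp_le)
    (simp_all add: wnorm_square[OF pos_semidef_H] power_mult_distrib sigma_max_nonneg
      quadratic_form_le_sigma_max)

lemma c2_le_H1: "c2\<^sup>2 * (norm z)\<^sup>2 \<le> z \<bullet> (H1 *v z)"
  using sigma_min_le_quadratic_form[OF transpose_H1 H1_pos, of z] c2_pos by simp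

lemma c2_le_wnorm: "c2 * norm z \<le> wnorm H z"
  by (rule power2_le_imp_le[OF _ wnorm_nonneg])
    (use c2_le_H1[of z] H1_le_H[of z] in
      \<open>simp only: power_mult_distrib wnorm_square[OF pos_semidef_H]\<close>)

text \<open>Any nonzero vector compares the two bounds. The result gives
  \<open>\<omega> \<ge> 1\<close> and keeps the square of the contraction factor
  nonnegative.\<close>

lemma c2_le_c1: "c2 \<le> c1"
proof -
  have "c2 * norm (1 :: ('N, 'n) pdvec) \<le> c1 * norm (1 :: ('N, 'n) pdvec)"
    using c2_le_wnorm[of 1] wnorm_le_c1[of 1] by linarith
  then show ?thesis by (simp add: mult_le_cancel_right)
qed

lemma c1_pos: "0 < c1"
  using c2_pos c2_le_c1 by linarith

text \<open>The Fejer inequality with its left-hand side dropped; it keeps the prediction close to a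
  saddle point near \<open>u\<close>.\<close>

lemma norm_residual_le:
  assumes "w \<in> Mstar"
  shows "c2 * norm (u - predicted u 0) \<le> wnorm H (u - w)"
proof (rule power2_le_imp_le[OF _ wnorm_nonneg])
  have "0 \<in> kkt_map F G V w" using assms saddle_points_eq_kkt_zeros by auto
  from corrected_fejer[OF this, of u]
  have "(u - predicted u 0) \<bullet> (H1 *v (u - predicted u 0)) \<le> (wnorm H (u - w))\<^sup>2"
    using zero_le_power2[of "wnorm H (corrected u 0 - w)"] by linarith
  with c2_le_H1[of "u - predicted u 0"]
  show "(c2 * norm (u - predicted u 0))\<^sup>2 \<le> (wnorm H (u - w))\<^sup>2"
    by (simp only: power_mult_distrib)
qed

text \<open>Subregularity at the prediction bounds its distance to the saddle points by
  \<open>K\<close> times the gap. Going back to \<open>u\<close> adds one gap, and each of the two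
  terms costs \<open>c1\<close> on passing to the \<open>H\<close>-norm.\<close>

lemma local_error_bound:
  assumes sub: "metrically_subregular (kkt_map F G V) w 0"
  obtains \<delta> K where "0 < \<delta>" "0 \<le> K"
    "\<And>u. dist u w < \<delta> \<Longrightarrow> wdist H u Mstar \<le> c1 * (K + 1) * norm (u - predicted u 0)"
proof -
  obtain \<epsilon> \<kappa> where w: "0 \<in> kkt_map F G V w" and \<epsilon>: "0 < \<epsilon>" and \<kappa>: "0 \<le> \<kappa>"
    and reg: "\<And>u. dist u w < \<epsilon> \<Longrightarrow> kkt_map F G V u \<noteq> {} \<Longrightarrow>
        infdist u Mstar \<le> \<kappa> * infdist 0 (kkt_map F G V u)"
    using sub unfolding metrically_subregular_def saddle_points_eq_kkt_zeros by blast
  have wM: "w \<in> Mstar" using w saddle_points_eq_kkt_zeros by auto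
  obtain C where C: "0 \<le> C"
    "\<And>u. \<exists>v\<in>kkt_map F G V (predicted u 0). norm v \<le> C * norm (u - predicted u 0)"
    using kkt_residual by blast
  \<comment> \<open>The prediction is at most \<open>q\<close> times as far from \<open>w\<close> as
    \<open>u\<close> is, hence the radius \<open>\<epsilon> / q\<close>.\<close>
  define q where "q = c1 / c2 + 1"
  have q: "1 \<le> q" using c1_pos c2_pos by (simp add: q_def)
  have "wdist H u Mstar \<le> c1 * (\<kappa> * C + 1) * norm (u - predicted u 0)" if u: "dist u w < \<epsilon> / q" for u
  proof -
    define e where "e = u - predicted u 0"
    have "c2 * norm e \<le> c1 * norm (u - w)"
      using norm_residual_le[OF wM, of u] wnorm_le_c1[of "u - w"] by (simp only: e_def)
    then have "norm e \<le> c1 / c2 * norm (u - w)" using c2_pos by (simp add: field_simps)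
    moreover have "dist (predicted u 0) w \<le> norm e + norm (u - w)"
      using dist_triangle[of "predicted u 0" w u] by (simp add: dist_norm e_def norm_minus_commute)
    ultimately have "dist (predicted u 0) w \<le> q * norm (u - w)" by (simp add: q_def distrib_right)
    also have "\<dots> < \<epsilon>" using u q by (simp add: dist_norm field_simps)
    finally have near: "dist (predicted u 0) w < \<epsilon>" .
    obtain v where v: "v \<in> kkt_map F G V (predicted u 0)" "norm v \<le> C * norm e"
      using C(2)[of u] by (auto simp: e_def)
    have "infdist 0 (kkt_map F G V (predicted u 0)) \<le> C * norm e"
      using infdist_le[OF v(1), of 0] v(2) by simp
    then have "\<kappa> * infdist 0 (kkt_map F G V (predicted u 0)) \<le> \<kappa> * (C * norm e)"
      using \<kappa> by (intro mult_left_mono)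
    with reg[OF near] v(1) have inf: "infdist (predicted u 0) Mstar \<le> \<kappa> * (C * norm e)" by force
    let ?S = "\<lambda>z. psd_sqrt H *v z"
    have "infdist (?S (predicted u 0)) (?S ` Mstar) / c1 \<le> infdist (predicted u 0) Mstar"
    proof (rule infdist_greatest)
      fix p assume "p \<in> Mstar"
      then have "infdist (?S (predicted u 0)) (?S ` Mstar) \<le> dist (?S (predicted u 0)) (?S p)"
        by (intro infdist_le imageI)
      also have "\<dots> \<le> c1 * dist (predicted u 0) p"
        unfolding dist_psd_sqrt_H using wnorm_le_c1[of "predicted u 0 - p"] by (simp add: dist_norm)
      finally show "infdist (?S (predicted u 0)) (?S ` Mstar) / c1 \<le> dist (predicted u 0) p"
        using c1_pos by (simp add: field_simps)
    qed (use wM in auto)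
    then have "infdist (?S (predicted u 0)) (?S ` Mstar) \<le> c1 * infdist (predicted u 0) Mstar"
      using c1_pos by (simp add: field_simps)
    also have "\<dots> \<le> c1 * (\<kappa> * (C * norm e))" using inf c1_pos by (intro mult_left_mono) auto
    finally have "infdist (?S (predicted u 0)) (?S ` Mstar) \<le> c1 * (\<kappa> * (C * norm e))" .
    moreover have "dist (?S u) (?S (predicted u 0)) \<le> c1 * norm e"
      unfolding dist_psd_sqrt_H e_def by (rule wnorm_le_c1)
    moreover have "wdist H u Mstar = infdist (?S u) (?S ` Mstar)"
      using wM by (intro wdist_eq_infdist[OF pos_semidef_H]) auto
    ultimately have "wdist H u Mstar \<le> c1 * (\<kappa> * (C * norm e)) + c1 * norm e"
      using infdist_triangle[of "?S u" "?S ` Mstar" "?S (predicted u 0)"] by linarith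
    then show ?thesis by (simp add: e_def algebra_simps)
  qed
  with that[of "\<epsilon> / q" "\<kappa> * C"] \<epsilon> q \<kappa> C(1) show ?thesis by simp
qed

text \<open>\<open>X\<close> stands for \<open>\<kappa> * \<kappa>2 * c1 + 1\<close>. The error
  bound turns the Fejer decrease into the fixed fraction
  \<open>c2\<^sup>2 / (c1\<^sup>2 * X\<^sup>2)\<close> of the squared distance.\<close>

lemma inexact_step_contraction:
  assumes ne: "Mstar \<noteq> {}"
    and err: "wdist H u Mstar \<le> c1 * X * norm (u - predicted u 0)" and X: "1 \<le> X"
    and \<theta>: "0 \<le> \<theta>" "\<theta>\<^sup>2 = 1 - c2\<^sup>2 / (c1\<^sup>2 * X\<^sup>2)"
    and \<rho>: "0 \<le> \<rho>" "\<mu>bar / c2 * \<rho> < 1"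
    and d: "norm d \<le> \<rho> * norm (upper u - upper (corrected u d))" and \<omega>: "1 \<le> \<omega>"
  shows "wdist H (corrected u d) Mstar
    \<le> (\<mu>bar / c2 * \<rho> * (1 + \<omega>) + \<theta>) / (1 - \<mu>bar / c2 * \<rho>) * wdist H u Mstar"
proof -
  define e where "e = u - predicted u 0"
  let ?S = "\<lambda>z. psd_sqrt H *v z"
  have \<mu>0: "0 \<le> \<mu>bar"
    using \<beta>_pos sigma_max_nonneg[of V] sigma_max_nonneg[of \<Gamma>] sigma_max_nonneg[of "psd_sqrt H ** M"]
    by simp
  note wdist = wdist_eq_infdist[OF pos_semidef_H ne]
  show ?thesis
    unfolding wdist
  proof (rule infdist_perturbed_contraction[where \<eta> = "c2\<^sup>2 * (norm e)\<^sup>2" and b = "?S (corrected u 0)"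
        and r = "c2\<^sup>2 / (c1\<^sup>2 * X\<^sup>2)"])
    show "?S ` Mstar \<noteq> {}" using ne by simp
    show "0 \<le> c2\<^sup>2 * (norm e)\<^sup>2" by simp
    show "(dist (?S (corrected u 0)) p)\<^sup>2 \<le> (dist (?S u) p)\<^sup>2 - c2\<^sup>2 * (norm e)\<^sup>2"
      if p: "p \<in> ?S ` Mstar" for p
    proof -
      obtain w where w: "w \<in> Mstar" "p = ?S w" using p by blast
      then have "0 \<in> kkt_map F G V w" using saddle_points_eq_kkt_zeros by auto
      from corrected_fejer[OF this, of u] c2_le_H1[of e]
      show ?thesis unfolding w(2) dist_psd_sqrt_H e_def by linarith
    qed
    have "(infdist (?S u) (?S ` Mstar))\<^sup>2 \<le> (c1 * X * norm e)\<^sup>2"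
      using err unfolding wdist e_def by (intro power_mono infdist_nonneg)
    then have "c2\<^sup>2 / (c1\<^sup>2 * X\<^sup>2) * (infdist (?S u) (?S ` Mstar))\<^sup>2
        \<le> c2\<^sup>2 / (c1\<^sup>2 * X\<^sup>2) * (c1 * X * norm e)\<^sup>2"
      by (intro mult_left_mono) simp_all
    also have "\<dots> = c2\<^sup>2 * (norm e)\<^sup>2"
      using c1_pos X by (simp only: power_mult_distrib) (simp add: field_simps)
    finally show "c2\<^sup>2 / (c1\<^sup>2 * X\<^sup>2) * (infdist (?S u) (?S ` Mstar))\<^sup>2 \<le> c2\<^sup>2 * (norm e)\<^sup>2" .
    show "dist (?S (corrected u d)) (?S (corrected u 0))
        \<le> \<mu>bar / c2 * \<rho> * dist (?S u) (?S (corrected u d))"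
    proof -
      \<comment> \<open>The error criterion sees the primal block alone; it is enlarged to the full
        step and then to the \<open>H\<close>-norm through \<open>c2\<close>.\<close>
      have "norm (upper u - upper (corrected u d)) \<le> norm (u - corrected u d)"
        using norm_le_norm_col(1)[of "upper (u - corrected u d)" "lower (u - corrected u d)"]
        by (simp only: col_upper_lower) simp
      also have "\<dots> \<le> wnorm H (u - corrected u d) / c2"
        using c2_le_wnorm[of "u - corrected u d"] c2_pos by (simp add: field_simps)
      finally have "norm d \<le> \<rho> * (wnorm H (u - corrected u d) / c2)"
        using d \<rho>(1) by (meson mult_left_mono order_trans)
      then have "\<mu>bar * norm d \<le> \<mu>bar * (\<rho> * (wnorm H (u - corrected u d) / c2))"
        using \<mu>0 by (intro mult_left_mono)
      then show ?thesis
        unfolding dist_psd_sqrt_H using corrected_perturbation[of u d 0] by simp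
    qed
    show "0 \<le> \<mu>bar / c2 * \<rho>" using \<mu>0 \<rho>(1) c2_pos by simp
  qed (fact \<theta> \<rho>(2) \<omega>)+
qed

end

section \<open>The local linear rate\<close>

theorem theorem4:
  fixes f :: "'N::finite \<Rightarrow> real ^ 'n::finite \<Rightarrow> real"
    and g :: "'N \<Rightarrow> real ^ 'n \<Rightarrow> ereal"
    and L \<tau> :: "'N \<Rightarrow> real"
    and \<beta> :: real
    and E :: "('N \<times> 'N) set"
    and W :: "real ^ 'N ^ 'N"
    and F :: "('N, 'n) svec \<Rightarrow> real"
    and G :: "('N, 'n) svec \<Rightarrow> ereal"
    and V \<Gamma> LF :: "('N, 'n) smat"
    and Q M H Gm H1 :: "('N, 'n) pdmat"
    and \<epsilon> \<rho> :: "nat \<Rightarrow> real"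
    and d x \<alpha> xt \<alpha>t :: "nat \<Rightarrow> ('N, 'n) svec"
    and u :: "nat \<Rightarrow> ('N, 'n) pdvec"
    and u_inf :: "('N, 'n) pdvec"
    and Mstar :: "('N, 'n) pdvec set"
    and \<mu>bar \<mu> \<omega> c1 c2 \<kappa>2 :: real
    and k0 :: nat
  assumes L_pos: "\<And>i. 0 < L i"
    and f_convex: "\<And>i. convex_on UNIV (f i)"
    and f_smooth: "\<And>i. smooth_fun (L i) (f i)"
    and g_pcc: "\<And>i. proper_closed_convex (g i)"
    and optimal: "\<exists>z. optimal_solution f g z"
    and graph: "connected_graph E"
    and mixing: "mixing_matrix E W"
    and F_def: "F = stacked_sum f"
    and G_def: "G = stacked_sum g"
    and V_def: "V = psd_sqrt (mat 1 - kronecker W (mat 1))"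
    and \<Gamma>_def: "\<Gamma> = agent_diag \<tau>"
    and LF_def: "LF = agent_diag L"
    and Q_def: "Q = block_mat (matrix_inv \<Gamma>) V 0 (mat (1 / \<beta>))"
    and M_def: "M = block_mat (mat 1) (\<Gamma> ** V) 0 (mat 1)"
    and H_def: "H = Q ** matrix_inv M"
    and Gm_def: "Gm = transpose Q + Q - transpose M ** H ** M"
    and H1_def: "H1 = Gm - (1/2) *\<^sub>R block_mat LF 0 0 0"
    and Mstar_def: "Mstar = saddle_points F G V"
    and \<tau>_range: "\<And>i. 0 < \<tau> i \<and> \<tau> i < 2 / L i"
    and \<beta>_range: "0 < \<beta>" "\<beta> \<le> 0.5 / (MAX i. \<tau> i)"
    and \<mu>bar_def: "\<mu>bar = sigma_max (psd_sqrt H ** M) * sigma_max \<Gamma> * (\<beta> * sigma_max V + 1)"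
    and c1_def: "c1 = sqrt (sigma_max H)"
    and c2_def: "c2 = sqrt (sigma_min H1)"
    and \<mu>_def: "\<mu> = \<mu>bar / c2"
    and \<omega>_def: "\<omega> = sqrt (c1 / c2)"
    and \<kappa>2_def: "\<kappa>2 = sqrt (max (3 * sigma_max (V ** V) + 1 / \<beta>\<^sup>2)
                           (3 * (MAX i. (L i)\<^sup>2) + 3 * sigma_min (matrix_inv \<Gamma> ** matrix_inv \<Gamma>))
                      / sigma_min H1)"
    and \<epsilon>_summable: "\<And>k. 0 \<le> \<epsilon> k" "summable \<epsilon>"
    and d_bound: "\<And>k i. norm (agent_block (d k) i) \<le> \<epsilon> k"
    and algorithm: "D_iPGM F G V \<Gamma> \<beta> M d x \<alpha> xt \<alpha>t"
    and u_def: "u = (\<lambda>k. col (x k) (\<alpha> k))"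
    and k0_pos: "0 < k0"
    and \<rho>_nonneg: "\<And>k. k \<ge> k0 \<Longrightarrow> 0 \<le> \<rho> k"
    and \<rho>_sup: "bdd_above (\<rho> ` {k0..})" "(SUP k\<in>{k0..}. \<rho> k) < 1 / \<mu>bar"
    and d_relative: "\<And>k. k \<ge> k0 \<Longrightarrow> norm (d k) \<le> \<rho> k * norm (x k - x (Suc k))"
    and u_lim: "u \<longlonglongrightarrow> u_inf"
    and subregular: "metrically_subregular (kkt_map F G V) u_inf 0"
  shows "\<exists>kbar>0. \<exists>\<kappa>>0. \<exists>\<theta>bar\<ge>0. \<exists>\<theta> :: nat \<Rightarrow> real.
           \<theta>bar\<^sup>2 = 1 - c2\<^sup>2 / (c1\<^sup>2 * (\<kappa> * \<kappa>2 * c1 + 1)\<^sup>2) \<and>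
           \<theta>bar\<^sup>2 < 1 \<and>
           (\<forall>k. \<theta> k = (\<mu> * (1 + \<omega>) * \<rho> k + \<theta>bar) / (1 - \<mu> * \<rho> k)) \<and>
           (\<forall>k\<ge>kbar. \<mu> * \<rho> k < 1 \<longrightarrow>
              wdist H (u (Suc k)) Mstar \<le> \<theta> k * wdist H (u k) Mstar) \<and>
           ((SUP k\<in>{kbar..}. \<rho> k) < (1 - \<theta>bar) / (\<mu> * (2 + \<omega>)) \<longrightarrow>
              (\<forall>k\<ge>kbar. \<theta> k < 1) \<and>
              converges_Q_linearly (\<lambda>k. wdist H (u k) Mstar))"
proof -
  have \<tau>_pos: "\<And>i. 0 < \<tau> i" and \<tau>_less: "\<And>i. \<tau> i < 2 / L i" using \<tau>_range by auto
  have lap: "pos_semidef (mat 1 - kronecker W (mat 1) :: ('N, 'n) smat)"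
    by (rule pos_semidef_mixing_laplacian[OF mixing])
  have V_sym: "transpose V = V"
    using pos_semidef_psd_sqrt[OF lap] by (simp add: V_def pos_semidef_def)
  have V_sq: "V ** V = mat 1 - kronecker W (mat 1)"
    unfolding V_def by (rule psd_sqrt_square[OF lap])
  have V_bound: "(norm (V *v y))\<^sup>2 < 2 * (norm y)\<^sup>2" if "y \<noteq> 0" for y
    using mixing_laplacian_less_2[OF mixing that] inner_gram[of y V y]
    by (simp add: V_sym V_sq dot_square_norm)
  have \<tau>_\<beta>: "2 * \<tau> i \<le> 1 / \<beta>" for i
  proof -
    have m: "\<tau> i \<le> (MAX i. \<tau> i)" by simp
    then have "0 < (MAX i. \<tau> i)" using \<tau>_pos[of i] by linarith
    then have "2 * (MAX i. \<tau> i) \<le> 1 / \<beta>" using \<beta>_range by (simp add: field_simps)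
    with m show ?thesis by linarith
  qed
  interpret P: consensus_problem f g L \<tau> \<beta> V
    by unfold_locales (fact L_pos f_convex f_smooth g_pcc V_sym V_bound \<tau>_pos \<tau>_less \<beta>_range(1) \<tau>_\<beta>)+
  have M: "M = P.M" by (simp add: M_def P.M_def \<Gamma>_def)
  have H: "H = P.H" by (simp add: H_def P.H_def Q_def P.Q_def M \<Gamma>_def)
  have H1: "H1 = P.H1"
    by (simp add: H1_def P.H1_def Gm_def P.Gm_def Q_def P.Q_def M H LF_def \<Gamma>_def)
  have c1: "c1 = P.c1" and c2: "c2 = P.c2" by (simp_all add: c1_def c2_def H H1)
  have \<mu>bar: "\<mu>bar = P.\<mu>bar" by (simp add: \<mu>bar_def H M \<Gamma>_def)
  have c_pos: "0 < c1" "0 < c2" and c_le: "c2 \<le> c1"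
    unfolding c1 c2 by (fact P.c1_pos P.c2_pos P.c2_le_c1)+
  have \<omega>: "1 \<le> \<omega>" using c_pos c_le by (simp add: \<omega>_def)
  have \<mu>0: "0 \<le> \<mu>"
    using c_pos \<beta>_range sigma_max_nonneg[of V] sigma_max_nonneg[of \<Gamma>]
      sigma_max_nonneg[of "psd_sqrt H ** M"] by (simp add: \<mu>_def \<mu>bar_def)
  have \<kappa>2: "0 < \<kappa>2"
  proof -
    have "0 < 3 * sigma_max (V ** V) + 1 / \<beta>\<^sup>2"
      using sigma_max_nonneg[of "V ** V"] \<beta>_range(1) by (intro add_nonneg_pos) auto
    moreover have "0 < sigma_min H1" using c_pos(2) by (simp add: c2_def)
    ultimately show ?thesis unfolding \<kappa>2_def by (simp add: less_max_iff_disj)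
  qed
  have step: "u (Suc k) = P.corrected (u k) (d k)" for k
  proof -
    have "xt k = P.predictor (x k) (\<alpha> k) (d k)" "\<alpha>t k = \<alpha> k - \<beta> *\<^sub>R (V *v xt k)"
      and "col (x (Suc k)) (\<alpha> (Suc k)) =
          col (x k) (\<alpha> k) - M *v (col (x k) (\<alpha> k) - col (xt k) (\<alpha>t k))"
      using algorithm by (auto simp: D_iPGM_def P.predictor_def F_def G_def \<Gamma>_def)
    then show ?thesis by (simp add: u_def P.corrected_def P.predicted_def M)
  qed
  have ux: "upper (u k) = x k" for k by (simp add: u_def)
  have Ms: "Mstar = P.Mstar" by (simp add: Mstar_def F_def G_def)
  have sub: "metrically_subregular (kkt_map P.F P.G V) u_inf 0"
    using subregular by (simp add: F_def G_def)
  then have "u_inf \<in> P.Mstar"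
    unfolding P.saddle_points_eq_kkt_zeros by (simp add: metrically_subregular_def)
  then have ne: "P.Mstar \<noteq> {}" by blast
  obtain \<delta> K where \<delta>: "0 < \<delta>" and K: "0 \<le> K"
    and err: "\<And>v. dist v u_inf < \<delta> \<Longrightarrow>
      wdist P.H v P.Mstar \<le> P.c1 * (K + 1) * norm (v - P.predicted v 0)"
    using P.local_error_bound[OF sub] by blast
  obtain k1 where k1: "\<And>k. k \<ge> k1 \<Longrightarrow> dist (u k) u_inf < \<delta>"
    using metric_LIMSEQ_D[OF u_lim \<delta>] by blast
  \<comment> \<open>From here on the error criterion holds and the iterates lie in the neighbourhood
    of the error bound.\<close>
  define kbar where "kbar = max k0 k1"
  \<comment> \<open>any \<open>\<kappa>\<close> with \<open>\<kappa> * \<kappa>2 * c1 \<ge> K\<close> would do; the extra \<open>1\<close> keeps it positive\<close>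
  define \<kappa> where "\<kappa> = (K + 1) / (\<kappa>2 * c1)"
  have \<kappa>: "0 < \<kappa>" using K \<kappa>2 c_pos by (simp add: \<kappa>_def)
  define X where "X = \<kappa> * \<kappa>2 * c1 + 1"
  have X: "X = K + 2" using \<kappa>2 c_pos by (simp add: X_def \<kappa>_def)
  define r where "r = c2\<^sup>2 / (c1\<^sup>2 * X\<^sup>2)"
  have "c2\<^sup>2 \<le> c1\<^sup>2 * 1" using c_pos c_le by (simp add: power_mono)
  also have "\<dots> \<le> c1\<^sup>2 * X\<^sup>2" using X K by (intro mult_left_mono one_le_power) auto
  finally have r: "0 < r" "r \<le> 1" using c_pos X K by (simp_all add: r_def)
  define \<theta>bar where "\<theta>bar = sqrt (1 - r)"
  have \<theta>bar: "0 \<le> \<theta>bar" "\<theta>bar\<^sup>2 = 1 - r" using r by (simp_all add: \<theta>bar_def)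
  define \<theta> where "\<theta> k = (\<mu> * (1 + \<omega>) * \<rho> k + \<theta>bar) / (1 - \<mu> * \<rho> k)" for k
  \<comment> \<open>The condition keeps the denominator of \<open>\<theta> k\<close> positive;
    \<open>rate\<close> derives it from the bound on the supremum.\<close>
  have contract: "wdist H (u (Suc k)) Mstar \<le> \<theta> k * wdist H (u k) Mstar"
    if k: "k \<ge> kbar" and m: "\<mu> * \<rho> k < 1" for k
  proof -
    have "k \<ge> k0" "k \<ge> k1" using k by (auto simp: kbar_def)
    have "wdist P.H (u k) P.Mstar \<le> P.c1 * (K + 1) * norm (u k - P.predicted (u k) 0)"
      by (rule err[OF k1[OF \<open>k \<ge> k1\<close>]])
    also have "\<dots> \<le> P.c1 * X * norm (u k - P.predicted (u k) 0)"
      using P.c1_pos X by (intro mult_right_mono mult_left_mono) auto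
    finally have "wdist P.H (P.corrected (u k) (d k)) P.Mstar
      \<le> (P.\<mu>bar / P.c2 * \<rho> k * (1 + \<omega>) + \<theta>bar) / (1 - P.\<mu>bar / P.c2 * \<rho> k) * wdist P.H (u k) P.Mstar"
    proof (rule P.inexact_step_contraction[OF ne])
      show "1 \<le> X" using X K by simp
      show "\<theta>bar\<^sup>2 = 1 - P.c2\<^sup>2 / (P.c1\<^sup>2 * X\<^sup>2)" using \<theta>bar(2) by (simp only: r_def c1 c2)
      show "P.\<mu>bar / P.c2 * \<rho> k < 1" using m by (simp only: \<mu>_def \<mu>bar c2)
      show "norm (d k) \<le> \<rho> k * norm (upper (u k) - upper (P.corrected (u k) (d k)))"
        using d_relative[OF \<open>k \<ge> k0\<close>] by (simp only: step[symmetric] ux)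
    qed (fact \<theta>bar(1) \<rho>_nonneg[OF \<open>k \<ge> k0\<close>] \<omega>)+
    then show ?thesis
      unfolding H Ms step \<theta>_def \<mu>_def \<mu>bar c2 by (simp only: mult_ac)
  qed
  have rate: "(\<forall>k\<ge>kbar. \<theta> k < 1) \<and> converges_Q_linearly (\<lambda>k. wdist H (u k) Mstar)"
    if sup: "(SUP k\<in>{kbar..}. \<rho> k) < (1 - \<theta>bar) / (\<mu> * (2 + \<omega>))"
  proof -
    define s where "s = (SUP k\<in>{kbar..}. \<rho> k)"
    have \<rho>s: "\<rho> k \<le> s" if "k \<ge> kbar" for k
      unfolding s_def using that
      by (intro cSUP_upper bdd_above_mono[OF \<rho>_sup(1)]) (auto simp: kbar_def)
    have \<rho>0: "0 \<le> \<rho> k" if "k \<ge> kbar" for k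
      using \<rho>_nonneg that by (simp add: kbar_def)
    have s0: "0 \<le> s" using \<rho>0[of kbar] \<rho>s[of kbar] by simp
    \<comment> \<open>For \<open>\<mu> = 0\<close> the bound on the supremum is a division by zero,
      hence 0, and contradicts \<open>0 \<le> s\<close>.\<close>
    have "\<mu> \<noteq> 0" using sup s0 by (auto simp: s_def)
    then have \<mu>: "0 < \<mu>" using \<mu>0 by simp
    have "s * (\<mu> * (2 + \<omega>)) < 1 - \<theta>bar"
      using sup \<mu> \<omega> by (simp add: s_def pos_less_divide_eq)
    then have s1: "\<mu> * (1 + \<omega>) * s + \<theta>bar < 1 - \<mu> * s" by (simp add: algebra_simps)
    have num0: "0 \<le> \<mu> * (1 + \<omega>) * s" using \<mu> \<omega> s0 by simp
    \<comment> \<open>\<open>\<theta> k\<close> increases with \<open>\<rho> k\<close>, so its value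
      at the supremum \<open>s\<close> is a uniform rate.\<close>
    define q where "q = (\<mu> * (1 + \<omega>) * s + \<theta>bar) / (1 - \<mu> * s)"
    have den: "0 < 1 - \<mu> * s" using s1 num0 \<theta>bar(1) by linarith
    have q: "0 \<le> q" "q < 1" using s1 num0 \<theta>bar(1) den by (simp_all add: q_def)
    have m: "\<mu> * \<rho> k \<le> \<mu> * s" if "k \<ge> kbar" for k
      using \<rho>s[OF that] \<mu> by (intro mult_left_mono) auto
    have \<theta>q: "\<theta> k \<le> q" if "k \<ge> kbar" for k
      unfolding \<theta>_def q_def
    proof (rule frac_le)
      show "\<mu> * (1 + \<omega>) * \<rho> k + \<theta>bar \<le> \<mu> * (1 + \<omega>) * s + \<theta>bar"
        using \<rho>s[OF that] \<mu> \<omega> by (intro add_right_mono mult_left_mono) auto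
    qed (use m[OF that] den num0 \<theta>bar(1) in auto)
    \<comment> \<open>Q-linear convergence asks for a positive rate, while \<open>q\<close> may be
      0; hence the maximum with 1/2.\<close>
    have "wdist H (u (Suc k)) Mstar \<le> max q (1/2) * wdist H (u k) Mstar" if k: "k \<ge> kbar" for k
    proof -
      have "wdist H (u (Suc k)) Mstar \<le> \<theta> k * wdist H (u k) Mstar"
        using contract[OF k] m[OF k] den by linarith
      also have "\<dots> \<le> max q (1/2) * wdist H (u k) Mstar"
        using \<theta>q[OF k] unfolding H Ms wdist_eq_infdist[OF P.pos_semidef_H ne]
        by (intro mult_right_mono infdist_nonneg) auto
      finally show ?thesis .
    qed
    then have "\<forall>\<^sub>F k in sequentially. wdist H (u (Suc k)) Mstar \<le> max q (1/2) * wdist H (u k) Mstar"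
      unfolding eventually_sequentially by blast
    moreover have "0 < max q (1/2)" "max q (1/2) < 1" using q by auto
    ultimately have "converges_Q_linearly (\<lambda>k. wdist H (u k) Mstar)"
      unfolding converges_Q_linearly_def by blast
    moreover have "\<forall>k\<ge>kbar. \<theta> k < 1" using \<theta>q q(2) by fastforce
    ultimately show ?thesis by blast
  qed
  show ?thesis
  proof (intro exI conjI)
    show "0 < kbar" using k0_pos by (simp add: kbar_def)
    show "0 < \<kappa>" by (rule \<kappa>)
    show "0 \<le> \<theta>bar" by (rule \<theta>bar(1))
    show "\<theta>bar\<^sup>2 = 1 - c2\<^sup>2 / (c1\<^sup>2 * (\<kappa> * \<kappa>2 * c1 + 1)\<^sup>2)"
      using \<theta>bar(2) by (simp only: r_def X_def)
    show "\<theta>bar\<^sup>2 < 1" using \<theta>bar(2) r by simp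
    show "\<forall>k. \<theta> k = (\<mu> * (1 + \<omega>) * \<rho> k + \<theta>bar) / (1 - \<mu> * \<rho> k)" by (simp add: \<theta>_def)
    show "\<forall>k\<ge>kbar. \<mu> * \<rho> k < 1 \<longrightarrow> wdist H (u (Suc k)) Mstar \<le> \<theta> k * wdist H (u k) Mstar"
      using contract by blast
    show "(SUP k\<in>{kbar..}. \<rho> k) < (1 - \<theta>bar) / (\<mu> * (2 + \<omega>)) \<longrightarrow>
        (\<forall>k\<ge>kbar. \<theta> k < 1) \<and> converges_Q_linearly (\<lambda>k. wdist H (u k) Mstar)"
      using rate by blast
  qed
qed

end
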